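(* Let $\Omega\subsetneq\mathbb{C}^n$ be a bounded $\mathbb{C}$-strictly convex domain. (a) Then $\Omega$ is $B$-regular. (b) Assume that the canonical function for $\Omega$ admits a modulus of continuity $\omega$ such that $\sqrt{\omega}$ satisfies a Dini condition. Then every complex geodesic $\psi:\mathbb{D}\to\Omega$ of $\Omega$ extends as a continuous map on $\overline{\mathbb{D}}$.
   Context: $\mathbb{C}$-strictly convex: a convex domain $\Omega\subsetneq\mathbb{C}^n$ is $\mathbb{C}$-strictly convex if for each $p\in\partial\Omega$ there exists a (real) support hyperplane $\mathcal{H}_p$ of $\Omega$ containing $p$ such that the $\mathbb{C}$-affine hyperplane $\widetilde{\mathcal{H}}_p:=p+\big((\mathcal{H}_p-p)\cap i(\mathcal{H}_p-p)\big)$ satisfies $\widetilde{\mathcal{H}}_p\cap\overline\Omega=\{p\}$. $B$-regular: a bounded domain $\Omega\subset\mathbb{C}^n$ is $B$-regular if every $\varphi\in\mathcal{C}(\partial\Omega;\mathbb{R})$ is the uniform limit on $\partial\Omega$ of a sequence $(u_\nu)_{\nu\ge1}$ of continuous plurisubharmonic functions defined on open neighbourhoods of $\partial\Omega$ (each neighbourhood depending on $u_\nu$). Canonical function of a $B$-regular domain $\Omega$: the unique $u\in\mathcal{C}(\overline\Omega)$, plurisubharmonic on $\Omega$, solving $(dd^cu)^n=0$ on $\Omega$ (in the sense of Bedford–Taylor) with $u(z)=-2\|z\|^2$ for $z\in\partial\Omega$, where $\|\cdot\|$ is the Euclidean norm. (Existence and uniqueness on $B$-regular domains is a known theorem of Błocki;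 by part (a) the canonical function is defined for the domains considered.) A modulus of continuity of a function $u$ on $\overline\Omega$ is a non-decreasing function $\omega:[0,\infty)\to[0,\infty)$ with $\lim_{r\to0^+}\omega(r)=0$ and $|u(x)-u(y)|\leq\omega(\|x-y\|)$ for all $x,y\in\overline\Omega$. The function $\sqrt\omega$ satisfies a Dini condition if $\int_0^\varepsilon\frac{\sqrt{\omega(x)}}{x}\,dx<\infty$ for every $\varepsilon>0$. $\mathbb{D}$ is the open unit disc in $\mathbb{C}$. A complex geodesic of $\Omega$ is a holomorphic map $\psi:\mathbb{D}\to\Omega$ that is an isometry for the Kobayashi distances on $\mathbb{D}$ and $\Omega$. *)

theory Defs
  imports "HOL-Complex_Analysis.Complex_Analysis"
begin

section \<open>Convexity\<close>

definition support_hyperplane :: "'a::real_inner set \<Rightarrow> 'a \<Rightarrow> 'a set \<Rightarrow> bool" where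
  "support_hyperplane \<Omega> p H \<longleftrightarrow>
     p \<in> H \<and> (\<exists>a b. a \<noteq> 0 \<and> H = {z. a \<bullet> z = b} \<and> \<Omega> \<subseteq> {z. a \<bullet> z \<le> b})"

text \<open>The inner product on \<^typ>\<open>complex ^ 'n\<close> is the real one, so \<open>support_hyperplane\<close>
  refers to real hyperplanes there.\<close>

definition complex_part :: "complex ^ 'n \<Rightarrow> (complex ^ 'n) set \<Rightarrow> (complex ^ 'n) set" where
  "complex_part p H =
     (\<lambda>v. p + v) ` ((\<lambda>z. z - p) ` H \<inter> (\<lambda>z. \<i> *s (z - p)) ` H)"

definition C_strictly_convex :: "(complex ^ 'n) set \<Rightarrow> bool" where
  "C_strictly_convex \<Omega> \<longleftrightarrow>
     open \<Omega> \<and> \<Omega> \<noteq> {} \<and> convex \<Omega> \<and> \<Omega> \<noteq> UNIV \<and>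
     (\<forall>p \<in> frontier \<Omega>. \<exists>H. support_hyperplane \<Omega> p H \<and>
        complex_part p H \<inter> closure \<Omega> = {p})"


section \<open>Continuous plurisubharmonic functions and B-regularity\<close>

text \<open>The sub-mean value property is required on all closed affine discs contained in \<open>U\<close>.
  Continuity (with finite values) is part of the definition, so the integral is meaningful.\<close>

definition continuous_psh_on :: "(complex ^ 'n) set \<Rightarrow> (complex ^ 'n \<Rightarrow> real) \<Rightarrow> bool" where
  "continuous_psh_on U u \<longleftrightarrow>
     continuous_on U u \<and>
     (\<forall>a b. (\<forall>\<zeta> \<in> cball 0 1. a + \<zeta> *s b \<in> U) \<longrightarrow>
        u a \<le> integral {0..2 * pi} (\<lambda>\<theta>. u (a + cis \<theta> *s b)) / (2 * pi))"

definition B_regular :: "(complex ^ 'n) set \<Rightarrow> bool" where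
  "B_regular \<Omega> \<longleftrightarrow>
     open \<Omega> \<and> connected \<Omega> \<and> \<Omega> \<noteq> {} \<and> bounded \<Omega> \<and>
     (\<forall>\<phi> :: complex ^ 'n \<Rightarrow> real. continuous_on (frontier \<Omega>) \<phi> \<longrightarrow>
        (\<exists>(u :: nat \<Rightarrow> complex ^ 'n \<Rightarrow> real) U.
           (\<forall>\<nu>. open (U \<nu>) \<and> frontier \<Omega> \<subseteq> U \<nu> \<and> continuous_psh_on (U \<nu>) (u \<nu>)) \<and>
           uniform_limit (frontier \<Omega>) u \<phi> sequentially))"


section \<open>Test functions\<close>

primrec C_k :: "nat \<Rightarrow> ('a::real_normed_vector \<Rightarrow> 'b::real_normed_vector) \<Rightarrow> bool" where
  "C_k 0 f \<longleftrightarrow> continuous_on UNIV f"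
| "C_k (Suc k) f \<longleftrightarrow>
     (\<forall>x. f differentiable (at x)) \<and> (\<forall>v. C_k k (\<lambda>x. frechet_derivative f (at x) v))"

definition support :: "('a::topological_space \<Rightarrow> 'b::zero) \<Rightarrow> 'a set" where
  "support f = closure {x. f x \<noteq> 0}"

definition C_c :: "'a::topological_space set \<Rightarrow> ('a \<Rightarrow> complex) set" where
  "C_c \<Omega> = {f. continuous_on UNIV f \<and> compact (support f) \<and> support f \<subseteq> \<Omega>}"

definition C_c_infinity :: "'a::real_normed_vector set \<Rightarrow> ('a \<Rightarrow> complex) set" where
  "C_c_infinity \<Omega> = {f \<in> C_c \<Omega>. \<forall>k. C_k k f}"


section \<open>The complex Monge-Ampere operator of Bedford and Taylor\<close>

definition d_z :: "'n \<Rightarrow> (complex ^ 'n \<Rightarrow> complex) \<Rightarrow> complex ^ 'n \<Rightarrow> complex" where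
  "d_z j f x =
     (frechet_derivative f (at x) (axis j 1) - \<i> * frechet_derivative f (at x) (axis j \<i>)) / 2"

definition d_zbar :: "'n \<Rightarrow> (complex ^ 'n \<Rightarrow> complex) \<Rightarrow> complex ^ 'n \<Rightarrow> complex" where
  "d_zbar j f x =
     (frechet_derivative f (at x) (axis j 1) + \<i> * frechet_derivative f (at x) (axis j \<i>)) / 2"

text \<open>Complex Radon measures on \<open>\<Omega>\<close>, as functionals on \<open>C_c \<Omega>\<close>.\<close>

definition radon_functional ::
    "(complex ^ 'n) set \<Rightarrow> ((complex ^ 'n \<Rightarrow> complex) \<Rightarrow> complex) \<Rightarrow> bool" where
  "radon_functional \<Omega> \<Lambda> \<longleftrightarrow>
     (\<forall>f \<in> C_c \<Omega>. \<forall>g \<in> C_c \<Omega>. \<Lambda> (\<lambda>x. f x + g x) = \<Lambda> f + \<Lambda> g) \<and>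
     (\<forall>f \<in> C_c \<Omega>. \<forall>c. \<Lambda> (\<lambda>x. c * f x) = c * \<Lambda> f) \<and>
     (\<forall>K. compact K \<and> K \<subseteq> \<Omega> \<longrightarrow>
        (\<exists>C. \<forall>f \<in> C_c \<Omega>. \<forall>M. support f \<subseteq> K \<and> (\<forall>x. cmod (f x) \<le> M) \<longrightarrow>
           cmod (\<Lambda> f) \<le> C * M))"

text \<open>
  A current \<open>T\<close> of bidegree \<open>(k,k)\<close> and order zero on \<open>\<Omega>\<close> is represented by its coefficients:
  for a list \<open>L = [(j\<^sub>1,l\<^sub>1), \<dots>, (j\<^sub>m,l\<^sub>m)]\<close> of length \<open>m = n - k\<close> and a function \<open>f\<close> in \<open>C_c \<Omega>\<close>,
  \<open>T L f\<close> is the value of \<open>T\<close> on the form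
  \<open>f (i dz\<^bsub>j1\<^esub> \<and> dzbar\<^bsub>l1\<^esub>) \<and> \<dots> \<and> (i dz\<^bsub>jm\<^esub> \<and> dzbar\<^bsub>lm\<^esub>)\<close>. These forms span the
  forms of bidegree \<open>(m,m)\<close> with coefficients in \<open>C_c \<Omega>\<close>.

  The convention is \<open>dd\<^sup>c = 2 i \<partial>\<partial>bar\<close>. For \<open>k = 0\<close> one has the constant function 1: if \<open>m = n\<close>,
  the wedge product of the \<open>i dz\<^bsub>j\<^esub> \<and> dzbar\<^bsub>l\<^esub>\<close>, \<open>(j,l) \<in> L\<close>, is \<open>2\<^sup>n sign \<pi>\<close> times the volume form if
  \<open>L\<close> enumerates the graph of a permutation \<open>\<pi>\<close>, and it vanishes otherwise; this sign (or zero)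
  is the determinant of the incidence matrix of \<open>L\<close>. The recursive step is
  \<open>\<langle>(dd\<^sup>c u)\<^bsup>k+1\<^esup>, \<phi>\<rangle> = \<langle>u (dd\<^sup>c u)\<^bsup>k\<^esup>, dd\<^sup>c \<phi>\<rangle>\<close> for test forms \<open>\<phi>\<close>, together with the requirement that the
  new current again has order zero (so that its product with \<open>u\<close> makes sense); it determines
  the coefficients uniquely since test functions are dense in \<open>C_c \<Omega>\<close>.
\<close>

type_synonym 'n coeff_current =
  "('n \<times> 'n) list \<Rightarrow> (complex ^ 'n \<Rightarrow> complex) \<Rightarrow> complex"

primrec ddc_power ::
    "(complex ^ 'n) set \<Rightarrow> (complex ^ 'n \<Rightarrow> real) \<Rightarrow> nat \<Rightarrow> 'n coeff_current \<Rightarrow> bool" where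
  "ddc_power \<Omega> u 0 T \<longleftrightarrow>
     (\<forall>L. length L = CARD('n) \<longrightarrow> (\<forall>f \<in> C_c \<Omega>.
        T L f = 2 ^ CARD('n) * det (\<chi> j l. if (j, l) \<in> set L then 1 else 0) *
                (LINT x|lborel. f x)))"
| "ddc_power \<Omega> u (Suc k) T \<longleftrightarrow>
     (\<exists>S. ddc_power \<Omega> u k S \<and>
       (\<forall>L. length L + Suc k = CARD('n) \<longrightarrow>
          radon_functional \<Omega> (T L) \<and>
          (\<forall>f \<in> C_c_infinity \<Omega>.
             T L f = 2 * (\<Sum>j\<in>UNIV. \<Sum>l\<in>UNIV.
               S ((j, l) # L) (\<lambda>x. complex_of_real (u x) * d_z j (d_zbar l f) x)))))"

definition monge_ampere_zero :: "(complex ^ 'n) set \<Rightarrow> (complex ^ 'n \<Rightarrow> real) \<Rightarrow> bool" where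
  "monge_ampere_zero \<Omega> u \<longleftrightarrow>
     (\<exists>T. ddc_power \<Omega> u CARD('n) T \<and> (\<forall>f \<in> C_c_infinity \<Omega>. T [] f = 0))"

text \<open>Only the values of \<open>u\<close> on \<open>closure \<Omega>\<close> matter.\<close>

definition is_canonical_function ::
    "(complex ^ 'n) set \<Rightarrow> (complex ^ 'n \<Rightarrow> real) \<Rightarrow> bool" where
  "is_canonical_function \<Omega> u \<longleftrightarrow>
     continuous_on (closure \<Omega>) u \<and> continuous_psh_on \<Omega> u \<and> monge_ampere_zero \<Omega> u \<and>
     (\<forall>z \<in> frontier \<Omega>. u z = - 2 * (norm z)\<^sup>2)"


section \<open>Moduli of continuity\<close>

definition modulus_of_continuity ::
    "'a::real_normed_vector set \<Rightarrow> ('a \<Rightarrow> real) \<Rightarrow> (real \<Rightarrow> real) \<Rightarrow> bool" where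
  "modulus_of_continuity S u \<omega> \<longleftrightarrow>
     mono_on {0..} \<omega> \<and> (\<forall>r \<ge> 0. \<omega> r \<ge> 0) \<and> (\<omega> \<longlongrightarrow> 0) (at_right 0) \<and>
     (\<forall>x \<in> S. \<forall>y \<in> S. \<bar>u x - u y\<bar> \<le> \<omega> (norm (x - y)))"

definition Dini :: "(real \<Rightarrow> real) \<Rightarrow> bool" where
  "Dini h \<longleftrightarrow> (\<forall>\<epsilon> > 0. (\<integral>\<^sup>+ x \<in> {0<..<\<epsilon>}. ennreal (h x / x) \<partial>lborel) < \<infinity>)"


section \<open>Kobayashi distance and complex geodesics\<close>

definition hol_discs :: "(complex ^ 'n) set \<Rightarrow> (complex \<Rightarrow> complex ^ 'n) set" where
  "hol_discs \<Omega> =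
     {f. (\<forall>i. (\<lambda>\<zeta>. f \<zeta> $ i) holomorphic_on ball 0 1) \<and> f ` ball 0 1 \<subseteq> \<Omega>}"

definition poincare_dist :: "complex \<Rightarrow> complex \<Rightarrow> real" where
  "poincare_dist a b = artanh (cmod ((a - b) / (1 - cnj b * a)))"

text \<open>The infimum of the lengths of the chains of discs from \<open>F\<close> joining \<open>z\<close> to \<open>w\<close>. Taking the
  class of discs as a parameter covers domains in \<open>\<complex>\<close> and in \<^typ>\<open>complex ^ 'n\<close> at once.\<close>

definition chain_dist :: "(complex \<Rightarrow> 'a) set \<Rightarrow> 'a \<Rightarrow> 'a \<Rightarrow> real" where
  "chain_dist F z w = Inf {(\<Sum>i<m. poincare_dist (a i) (b i)) | m a b.
     \<exists>p f. p 0 = z \<and> p m = w \<and>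
       (\<forall>i<m. f i \<in> F \<and> a i \<in> ball 0 1 \<and> b i \<in> ball 0 1 \<and>
              f i (a i) = p i \<and> f i (b i) = p (Suc i))}"

definition kobayashi_dist :: "(complex ^ 'n) set \<Rightarrow> complex ^ 'n \<Rightarrow> complex ^ 'n \<Rightarrow> real" where
  "kobayashi_dist \<Omega> = chain_dist (hol_discs \<Omega>)"

definition kobayashi_dist_disc :: "complex \<Rightarrow> complex \<Rightarrow> real" where
  "kobayashi_dist_disc =
     chain_dist {f. f holomorphic_on ball 0 1 \<and> f ` ball 0 1 \<subseteq> ball 0 1}"

definition complex_geodesic :: "(complex ^ 'n) set \<Rightarrow> (complex \<Rightarrow> complex ^ 'n) \<Rightarrow> bool" where
  "complex_geodesic \<Omega> \<psi> \<longleftrightarrow>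
     \<psi> \<in> hol_discs \<Omega> \<and>
     (\<forall>z \<in> ball 0 1. \<forall>w \<in> ball 0 1.
        kobayashi_dist \<Omega> (\<psi> z) (\<psi> w) = kobayashi_dist_disc z w)"

end

theory Submission imports Defs begin

text \<open>For B-regularity, a supporting real functional at a boundary point \<open>p\<close> is the real part of a
  complex linear functional \<open>L\<close>, and a small multiple of \<open>L\<^sup>2\<close> turns \<open>L\<close> into a polynomial whose
  real part peaks exactly at \<open>p\<close>. Maxima of finitely many affine images of such peak functions
  approximate any continuous boundary function.

  For the extension of geodesics, put \<open>v z = u z + 2 \<parallel>z\<parallel>\<^sup>2\<close> with \<open>u\<close> the canonical function.
  Then \<open>v \<le> 0\<close>, and the sub-mean value property gives \<open>2 \<parallel>b\<parallel>\<^sup>2 \<le> - v p\<close> whenever the affine disc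
  \<open>p + \<zeta> b\<close> lies in the domain. By convexity and the Schwarz lemma this applies to
  \<open>b = (1 - \<bar>\<zeta>\<bar>) \<psi>' \<zeta> / 3\<close> at \<open>p = \<psi> \<zeta>\<close>, so \<open>(1 - \<bar>\<zeta>\<bar>) \<parallel>\<psi>' \<zeta>\<parallel>\<close> is at most a constant times
  \<open>sqrt (- v (\<psi> \<zeta>))\<close>, which the modulus of continuity bounds by the boundary distance of \<open>\<psi> \<zeta>\<close>.
  Comparing Kobayashi distances, that distance decays like a power of \<open>1 - \<bar>\<zeta>\<bar>\<close>. The Dini
  condition then makes the increments of \<open>\<psi>\<close> along the radii \<open>1 - 3\<^sup>-\<^sup>m\<close> summable, uniformly on
  the circle.\<close>

section \<open>Linear functionals and circle means\<close>

text \<open>The Hermitian form, conjugate linear in \<open>a\<close>, chosen so that its real part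
  is the real inner product; a real functional thereby becomes the real part of a complex linear
  one.\<close>

definition hprod :: "complex ^ 'n \<Rightarrow> complex ^ 'n \<Rightarrow> complex" where
  "hprod a z = (\<Sum>i\<in>UNIV. cnj (a $ i) * z $ i)"

lemma Re_hprod: "Re (hprod a z) = a \<bullet> z"
  by (simp add: hprod_def inner_vec_def inner_complex_def)

lemma hprod_add: "hprod a (x + y) = hprod a x + hprod a y"
  by (simp add: hprod_def ring_distribs sum.distrib)

lemma hprod_scale: "hprod a (c *s x) = c * hprod a x"
  by (simp add: hprod_def sum_distrib_left mult_ac)

lemma continuous_on_hprod [continuous_intros]:
  "continuous_on S f \<Longrightarrow> continuous_on S (\<lambda>x. hprod a (f x))"
  unfolding hprod_def by (intro continuous_intros)

lemma continuous_on_vector_scalar_mult [continuous_intros]: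
  fixes g :: "'a::topological_space \<Rightarrow> complex ^ 'n"
  shows "continuous_on S f \<Longrightarrow> continuous_on S g \<Longrightarrow> continuous_on S (\<lambda>x. f x *s g x)"
  unfolding vector_scalar_mult_def by (intro continuous_intros)

lemma norm_vector_scalar_mult: "norm (c *s x) = cmod c * norm (x :: complex ^ 'n)"
  by (simp add: norm_vec_def L2_set_def norm_mult power_mult_distrib sum_distrib_left [symmetric]
      real_sqrt_mult)

lemma norm_add_cis_scale:
  "(norm (a + cis \<theta> *s b))\<^sup>2 = (norm a)\<^sup>2 + (norm b)\<^sup>2 + 2 * Re (hprod a b * cis \<theta>)"
proof -
  have "(norm (a + cis \<theta> *s b))\<^sup>2 = (norm a)\<^sup>2 + (norm (cis \<theta> *s b))\<^sup>2 + 2 * (a \<bullet> (cis \<theta> *s b))"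
    by (simp add: power2_norm_eq_inner inner_add inner_commute)
  then show ?thesis
    by (simp add: norm_vector_scalar_mult Re_hprod [symmetric] hprod_scale mult.commute)
qed

text \<open>Nonconstant powers of \<open>cis \<theta>\<close> have mean zero. Degree two covers both
  the peak polynomials and the squared norm on affine discs.\<close>

lemma has_integral_circle_quadratic:
  "((\<lambda>\<theta>. Re (A + B * cis \<theta> + C * (cis \<theta>)\<^sup>2)) has_integral 2 * pi * Re A) {0..2 * pi}"
proof -
  \<comment> \<open>A termwise antiderivative: \<open>- \<i> * cis \<theta>\<close> differentiates
    to \<open>cis \<theta>\<close>, and the division by 2 comes from reading
    \<open>(cis \<theta>)\<^sup>2\<close> as \<open>cis (2 * \<theta>)\<close>.\<close>
  define F where "F \<theta> = Re A * \<theta> + Re (- \<i> * B * cis \<theta>) + Re (- \<i> * C * cis (2 * \<theta>) / 2)" for \<theta>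
  have "((\<lambda>\<theta>. Re (A + B * cis \<theta> + C * (cis \<theta>)\<^sup>2)) has_integral (F (2 * pi) - F 0)) {0..2 * pi}"
  proof (rule fundamental_theorem_of_calculus)
    fix \<theta> :: real
    have "(F has_real_derivative Re (A + B * cis \<theta> + C * cis (2 * \<theta>))) (at \<theta> within {0..2 * pi})"
      unfolding F_def
      by (auto intro!: derivative_eq_intros simp: field_simps)
    then show "(F has_vector_derivative Re (A + B * cis \<theta> + C * (cis \<theta>)\<^sup>2)) (at \<theta> within {0..2 * pi})"
      by (simp add: has_real_derivative_iff_has_vector_derivative Complex.DeMoivre)
  qed simp
  moreover have "F (2 * pi) - F 0 = 2 * pi * Re A"
    by (simp add: F_def sin_double cos_double mult.assoc [symmetric])
  ultimately show ?thesis by simp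
qed

section \<open>B-regularity\<close>

text \<open>Real parts of holomorphic polynomials are pluriharmonic: on an affine disc the mean
  equals the value at the centre, whatever the sign of \<open>M\<close>.\<close>

lemma continuous_psh_on_peak:
  "continuous_psh_on UNIV (\<lambda>z. k + M * Re (hprod a (z - p) + d * (hprod a (z - p))\<^sup>2))"
  unfolding continuous_psh_on_def
proof (intro conjI allI impI)
  show "continuous_on UNIV (\<lambda>z. k + M * Re (hprod a (z - p) + d * (hprod a (z - p))\<^sup>2))"
    by (intro continuous_intros)
next
  fix x b :: "complex ^ 'a"
  let ?u = "\<lambda>z. k + M * Re (hprod a (z - p) + d * (hprod a (z - p))\<^sup>2)"
  let ?A = "hprod a (x - p)" and ?B = "hprod a b"
  have *: "hprod a (x + cis \<theta> *s b - p) = ?A + ?B * cis \<theta>" for \<theta>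
    using hprod_add [of a "x - p" "cis \<theta> *s b"] by (simp add: hprod_scale algebra_simps)
  have "?u (x + cis \<theta> *s b) = Re ((k + M * (?A + d * ?A\<^sup>2)) + M * (?B + 2 * d * ?A * ?B) * cis \<theta>
      + M * d * ?B\<^sup>2 * (cis \<theta>)\<^sup>2)" for \<theta>
  proof -
    have "(k + M * (?A + d * ?A\<^sup>2)) + M * (?B + 2 * d * ?A * ?B) * cis \<theta> + M * d * ?B\<^sup>2 * (cis \<theta>)\<^sup>2
        = k + M * ((?A + ?B * cis \<theta>) + d * (?A + ?B * cis \<theta>)\<^sup>2)"
      by (simp add: algebra_simps power2_eq_square)
    then have "Re ((k + M * (?A + d * ?A\<^sup>2)) + M * (?B + 2 * d * ?A * ?B) * cis \<theta> + M * d * ?B\<^sup>2 * (cis \<theta>)\<^sup>2)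
        = Re (complex_of_real k + complex_of_real M * ((?A + ?B * cis \<theta>) + d * (?A + ?B * cis \<theta>)\<^sup>2))"
      by (rule arg_cong)
    then show ?thesis unfolding * by (simp only: plus_complex.sel Re_complex_of_real scaleR_conv_of_real [symmetric] scaleR_complex.sel)
  qed
  then have "integral {0..2 * pi} (\<lambda>\<theta>. ?u (x + cis \<theta> *s b)) = 2 * pi * Re (k + M * (?A + d * ?A\<^sup>2))"
    using has_integral_circle_quadratic by (simp only: integral_unique)
  then show "?u x \<le> integral {0..2 * pi} (\<lambda>\<theta>. ?u (x + cis \<theta> *s b)) / (2 * pi)"
    by simp
qed

section \<open>Maxima of continuous plurisubharmonic functions\<close>

lemma integrable_on_circle:
  assumes "continuous_on U u" "\<And>\<zeta>. \<zeta> \<in> cball 0 1 \<Longrightarrow> a + \<zeta> *s b \<in> U"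
  shows "(\<lambda>\<theta>. u (a + cis \<theta> *s b) :: real) integrable_on {0..2 * pi}"
  by (intro integrable_continuous_interval continuous_on_compose2 [OF assms(1)] continuous_intros)
    (use assms(2) in auto)

lemma continuous_psh_on_max:
  assumes "continuous_psh_on U u" "continuous_psh_on U v"
  shows "continuous_psh_on U (\<lambda>z. max (u z) (v z))"
  unfolding continuous_psh_on_def
proof (intro conjI allI impI)
  show cont: "continuous_on U (\<lambda>z. max (u z) (v z))"
    using assms unfolding continuous_psh_on_def by (intro continuous_intros) auto
  fix a b assume ab: "\<forall>\<zeta>\<in>cball 0 1. a + \<zeta> *s b \<in> U"
  let ?I = "integral {0..2 * pi} (\<lambda>\<theta>. max (u (a + cis \<theta> *s b)) (v (a + cis \<theta> *s b))) / (2 * pi)"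
  have "w a \<le> ?I" if "continuous_psh_on U w" "\<And>z. w z \<le> max (u z) (v z)" for w
  proof -
    have "w a \<le> integral {0..2 * pi} (\<lambda>\<theta>. w (a + cis \<theta> *s b)) / (2 * pi)"
      using that(1) ab unfolding continuous_psh_on_def by blast
    also have "\<dots> \<le> ?I"
      using that ab cont unfolding continuous_psh_on_def
      by (intro divide_right_mono integral_le integrable_on_circle [of U w]
          integrable_on_circle [of U "\<lambda>z. max (u z) (v z)"]) auto
    finally show ?thesis .
  qed
  from this [of u] this [of v] assms show "max (u a) (v a) \<le> ?I" by simp
qed

lemma continuous_psh_on_Max:
  assumes "finite F" "F \<noteq> {}" "\<And>p. p \<in> F \<Longrightarrow> continuous_psh_on U (v p)"
  shows "continuous_psh_on U (\<lambda>z. Max ((\<lambda>p. v p z) ` F))"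
  using assms
proof (induction F rule: finite_ne_induct)
  case (insert x F)
  then have "continuous_psh_on U (\<lambda>z. max (v x z) (Max ((\<lambda>p. v p z) ` F)))"
    by (intro continuous_psh_on_max) auto
  with insert show ?case by simp
qed simp

section \<open>Peak functions at boundary points\<close>

lemma complex_part_hyperplane:
  assumes "a \<bullet> p = b" "hprod a (z - p) = 0"
  shows "z \<in> complex_part p {z. a \<bullet> z = b}"
proof -
  let ?v = "z - p"
  have "a \<bullet> ?v = 0" using Re_hprod [of a ?v] assms by simp
  then have "?v \<in> (\<lambda>z. z - p) ` {z. a \<bullet> z = b}"
    using assms by (auto simp: inner_diff)
  \<comment> \<open>\<open>?v\<close> is \<open>\<i>\<close> times \<open>(- \<i>) *s ?v\<close>,
    which \<open>hprod a\<close> kills as well; this puts \<open>?v\<close> into the rotated copy of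
    the hyperplane.\<close>
  moreover have "a \<bullet> (p + (- \<i>) *s ?v) = b"
    using Re_hprod [of a "(- \<i>) *s ?v"] assms
    by (simp only: inner_add hprod_scale) simp
  then have "?v \<in> (\<lambda>z. \<i> *s (z - p)) ` {z. a \<bullet> z = b}"
    by (intro image_eqI [of _ _ "p + (- \<i>) *s ?v"])
      (auto simp: vector_scalar_mult_def vec_eq_iff)
  ultimately show ?thesis
    unfolding complex_part_def by force
qed

lemma closure_half_space:
  "\<Omega> \<subseteq> {z. a \<bullet> z \<le> b} \<Longrightarrow> closure \<Omega> \<subseteq> {z. a \<bullet> z \<le> b}"
  by (simp add: closure_minimal closed_halfspace_le)

text \<open>In the peak polynomial the quadratic term contributes \<open>- d (Im w)\<^sup>2\<close>, and its other part
  \<open>d (Re w)\<^sup>2\<close> is absorbed by \<open>Re w \<le> 0\<close>, since \<open>w\<close> stays bounded.\<close>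

lemma peak_neg:
  assumes "Re w \<le> 0" "cmod w \<le> R" "R > 0" "w \<noteq> 0"
  shows "Re (w + of_real (1 / (2 * R)) * w\<^sup>2) < 0"
proof -
  define x y where "x = Re w" and "y = Im w"
  have "- x \<le> R" using assms abs_Re_le_cmod [of w] by (auto simp: x_def)
  then have "(- x) * (- x) \<le> R * (- x)" using assms by (intro mult_right_mono) (auto simp: x_def)
  then have 1: "x\<^sup>2 / (2 * R) \<le> - x / 2" using assms by (simp add: field_simps power2_eq_square)
  have 2: "x < 0 \<or> y \<noteq> 0" using assms complex_eqI [of w 0] by (auto simp: x_def y_def)
  have "Re (w + of_real (1 / (2 * R)) * w\<^sup>2) = x + x\<^sup>2 / (2 * R) - y\<^sup>2 / (2 * R)"
    by (simp add: x_def y_def Re_power2 diff_divide_distrib)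
  also have "\<dots> \<le> x / 2 - y\<^sup>2 / (2 * R)" using 1 by simp
  also have "\<dots> < 0"
  proof (cases "x < 0")
    case True
    moreover have "0 \<le> y\<^sup>2 / (2 * R)" using assms by simp
    ultimately show ?thesis by linarith
  next
    case False
    then have "0 < y\<^sup>2 / (2 * R)" using 2 assms by simp
    moreover have "x \<le> 0" using assms by (simp add: x_def)
    ultimately show ?thesis by linarith
  qed
  finally show ?thesis .
qed

text \<open>The supporting half-space makes \<open>Re (hprod a (z - p))\<close> nonpositive on the
  closure, and strict convexity leaves \<open>p\<close> as the only zero of
  \<open>hprod a (z - p)\<close> there, so \<open>peak_neg\<close> applies. The affine images
  \<open>k + M * h z\<close> are recorded because the peak is rescaled later.\<close>

lemma peak_function_exists:
  fixes \<Omega> :: "(complex ^ 'n) set"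
  assumes bdd: "bounded \<Omega>" and conv: "C_strictly_convex \<Omega>" and p: "p \<in> frontier \<Omega>"
  obtains h where "\<And>k M. continuous_psh_on UNIV (\<lambda>z. k + M * h z)" "h p = (0::real)"
    "\<And>z. z \<in> closure \<Omega> \<Longrightarrow> z \<noteq> p \<Longrightarrow> h z < 0"
proof -
  obtain H where H: "support_hyperplane \<Omega> p H" "complex_part p H \<inter> closure \<Omega> = {p}"
    using conv p unfolding C_strictly_convex_def by blast
  obtain a b where ab: "H = {z. a \<bullet> z = b}" "\<Omega> \<subseteq> {z. a \<bullet> z \<le> b}" and ap: "a \<bullet> p = b"
    using H(1) unfolding support_hyperplane_def by blast
  have "compact ((\<lambda>z. hprod a (z - p)) ` closure \<Omega>)"
    using bdd by (intro compact_continuous_image continuous_intros) auto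
  then obtain R where R: "R > 0" "\<And>z. z \<in> closure \<Omega> \<Longrightarrow> cmod (hprod a (z - p)) \<le> R"
    using bounded_pos [THEN iffD1, OF compact_imp_bounded] by (metis (no_types, lifting) imageI)
  define h where "h z = Re (hprod a (z - p) + of_real (1 / (2 * R)) * (hprod a (z - p))\<^sup>2)" for z
  show ?thesis
  proof
    show "continuous_psh_on UNIV (\<lambda>z. k + M * h z)" for k M
      unfolding h_def by (rule continuous_psh_on_peak)
    show "h p = 0" by (simp add: h_def hprod_def)
    fix z assume z: "z \<in> closure \<Omega>" "z \<noteq> p"
    have "Re (hprod a (z - p)) \<le> 0"
      using closure_half_space [OF ab(2)] z ap by (auto simp: Re_hprod inner_diff)
    moreover have "hprod a (z - p) \<noteq> 0"
      using complex_part_hyperplane [OF ap, of z] z H(2) ab(1) by blast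
    ultimately show "h z < 0"
      unfolding h_def using R z by (intro peak_neg) auto
  qed
qed

text \<open>Near \<open>p\<close> the constant \<open>\<phi> p - \<epsilon> / 2\<close> lies below
  \<open>\<phi>\<close> by continuity; away from \<open>p\<close> the peak function is bounded above
  by a negative constant, and a large multiple of it pushes the sum below
  \<open>\<phi>\<close>.\<close>

lemma psh_minorant_touching:
  fixes \<Omega> :: "(complex ^ 'n) set" and \<phi> :: "complex ^ 'n \<Rightarrow> real"
  assumes bdd: "bounded \<Omega>" and conv: "C_strictly_convex \<Omega>" and p: "p \<in> frontier \<Omega>"
    and \<phi>: "continuous_on (frontier \<Omega>) \<phi>" and e: "\<epsilon> > 0"
  shows "\<exists>v. continuous_psh_on UNIV v \<and> v p > \<phi> p - \<epsilon> \<and> (\<forall>z\<in>frontier \<Omega>. v z < \<phi> z)"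
proof -
  obtain h where h: "\<And>k M. continuous_psh_on UNIV (\<lambda>z. k + M * h z)" "h p = 0"
    "\<And>z. z \<in> closure \<Omega> \<Longrightarrow> z \<noteq> p \<Longrightarrow> h z < 0"
    using peak_function_exists [OF bdd conv p] by blast
  have cl: "frontier \<Omega> \<subseteq> closure \<Omega>" by (simp add: frontier_def)
  have K: "compact (frontier \<Omega>)" using bdd compact_frontier_bounded by blast
  have conth: "continuous_on UNIV h"
    using h(1) [of 0 1] by (simp add: continuous_psh_on_def)
  obtain r where r: "r > 0" "\<And>z. z \<in> frontier \<Omega> \<Longrightarrow> dist z p < r \<Longrightarrow> dist (\<phi> z) (\<phi> p) < \<epsilon> / 2"
    using \<phi> p e unfolding continuous_on_iff by (meson half_gt_zero)
  define K0 where "K0 = frontier \<Omega> - ball p r"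
  have K0: "compact K0" unfolding K0_def using K by (intro compact_diff) auto
  obtain m where m: "\<And>z. z \<in> frontier \<Omega> \<Longrightarrow> \<phi> p - m < \<phi> z" "m > 0"
  proof -
    have "bounded (\<phi> ` frontier \<Omega>)"
      using compact_continuous_image [OF \<phi> K] compact_imp_bounded by blast
    then obtain B where "B > 0" "\<And>z. z \<in> frontier \<Omega> \<Longrightarrow> \<bar>\<phi> z\<bar> \<le> B"
      unfolding bounded_pos by auto
    then have "\<phi> p - (2 * B + 1) < \<phi> z" if "z \<in> frontier \<Omega>" for z
      using p that by (smt (verit))
    with \<open>B > 0\<close> show ?thesis using that [of "2 * B + 1"] by simp
  qed
  obtain c where c: "c > 0" "\<And>z. z \<in> K0 \<Longrightarrow> h z \<le> - c"
  proof (cases "K0 = {}")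
    case True
    then show ?thesis using that [of 1] by simp
  next
    case False
    then obtain x where x: "x \<in> K0" "\<And>z. z \<in> K0 \<Longrightarrow> h z \<le> h x"
      using continuous_attains_sup [OF K0 False continuous_on_subset [OF conth]] by blast
    then have "x \<in> closure \<Omega>" "x \<noteq> p" using cl r(1) by (auto simp: K0_def)
    then have "h x < 0" by (rule h(3))
    with x show ?thesis using that [of "- h x"] by simp
  qed
  \<comment> \<open>On \<open>K0\<close> the second summand is at most \<open>- m\<close>, which
    suffices because \<open>\<phi> p - m\<close> is below \<open>\<phi>\<close>; at \<open>p\<close>
    it vanishes.\<close>
  let ?v = "\<lambda>z. (\<phi> p - \<epsilon> / 2) + m / c * h z"
  have "?v z < \<phi> z" if z: "z \<in> frontier \<Omega>" for z
  proof (cases "z \<in> ball p r")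
    case True
    then have "\<bar>\<phi> z - \<phi> p\<bar> < \<epsilon> / 2" using r z by (auto simp: dist_commute dist_real_def)
    moreover have "m / c * h z \<le> 0"
      using h(2) h(3) [of z] m c cl z by (cases "z = p") (auto simp: mult_nonneg_nonpos divide_nonpos_pos)
    ultimately show ?thesis by linarith
  next
    case False
    then have "m / c * h z \<le> m / c * (- c)"
      using c z m by (intro mult_left_mono) (auto simp: K0_def)
    then show ?thesis using m(1) [OF z] c e by simp
  qed
  then show ?thesis using h(2) e by (intro exI [of _ ?v] conjI h(1) ballI) auto
qed

text \<open>Each minorant stays within \<open>\<epsilon>\<close> of \<open>\<phi>\<close> near its
  base point; by compactness the maximum of finitely many of them does so on the whole
  frontier.\<close>

lemma psh_approximation:
  fixes \<Omega> :: "(complex ^ 'n) set" and \<phi> :: "complex ^ 'n \<Rightarrow> real"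
  assumes bdd: "bounded \<Omega>" and conv: "C_strictly_convex \<Omega>" and ne: "frontier \<Omega> \<noteq> {}"
    and \<phi>: "continuous_on (frontier \<Omega>) \<phi>" and e: "\<epsilon> > 0"
  shows "\<exists>u. continuous_psh_on UNIV u \<and> (\<forall>z\<in>frontier \<Omega>. \<bar>u z - \<phi> z\<bar> < \<epsilon>)"
proof -
  have K: "compact (frontier \<Omega>)" using bdd compact_frontier_bounded by blast
  obtain v where v: "\<And>p. p \<in> frontier \<Omega> \<Longrightarrow> continuous_psh_on UNIV (v p)"
    "\<And>p. p \<in> frontier \<Omega> \<Longrightarrow> v p p > \<phi> p - \<epsilon>"
    "\<And>p z. p \<in> frontier \<Omega> \<Longrightarrow> z \<in> frontier \<Omega> \<Longrightarrow> v p z < \<phi> z"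
    using psh_minorant_touching [OF bdd conv _ \<phi> e] by metis
  have "\<exists>r>0. \<forall>z\<in>frontier \<Omega> \<inter> ball p r. v p z > \<phi> z - \<epsilon>" if p: "p \<in> frontier \<Omega>" for p
  proof -
    have "continuous_on (frontier \<Omega>) (\<lambda>z. v p z - \<phi> z)"
      using v(1) [OF p] \<phi> unfolding continuous_psh_on_def
      by (intro continuous_intros) (auto intro: continuous_on_subset)
    moreover have "v p p - \<phi> p + \<epsilon> > 0" using v(2) [OF p] by simp
    ultimately obtain r where "r > 0" "\<forall>z\<in>frontier \<Omega>. dist z p < r \<longrightarrow>
        dist (v p z - \<phi> z) (v p p - \<phi> p) < v p p - \<phi> p + \<epsilon>"
      using p unfolding continuous_on_iff by meson
    then show ?thesis by (intro exI [of _ r]) (force simp: dist_real_def dist_commute)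
  qed
  then obtain r where r: "\<And>p. p \<in> frontier \<Omega> \<Longrightarrow> r p > 0"
    "\<And>p z. p \<in> frontier \<Omega> \<Longrightarrow> z \<in> frontier \<Omega> \<Longrightarrow> z \<in> ball p (r p) \<Longrightarrow> v p z > \<phi> z - \<epsilon>"
    by (metis IntI)
  have "frontier \<Omega> \<subseteq> (\<Union>p\<in>frontier \<Omega>. ball p (r p))" using r(1) by force
  then obtain F where F: "F \<subseteq> frontier \<Omega>" "finite F" "frontier \<Omega> \<subseteq> (\<Union>p\<in>F. ball p (r p))"
    using compactE_image [OF K, of "frontier \<Omega>" "\<lambda>p. ball p (r p)"] by blast
  have F0: "F \<noteq> {}" using F ne by auto
  let ?u = "\<lambda>z. Max ((\<lambda>p. v p z) ` F)"
  have "\<bar>?u z - \<phi> z\<bar> < \<epsilon>" if z: "z \<in> frontier \<Omega>" for z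
  proof -
    have "?u z < \<phi> z" using F F0 v(3) z by (auto simp: Max_less_iff)
    moreover obtain p where "p \<in> F" "z \<in> ball p (r p)" using F z by blast
    then have "\<phi> z - \<epsilon> < v p z" "v p z \<le> ?u z" using F r(2) [of p z] z by auto
    ultimately show ?thesis by linarith
  qed
  moreover have "continuous_psh_on UNIV ?u"
    using continuous_psh_on_Max [of F UNIV v] F F0 v by blast
  ultimately show ?thesis by blast
qed

lemma frontier_nonempty_C_strictly_convex: "C_strictly_convex \<Omega> \<Longrightarrow> frontier \<Omega> \<noteq> {}"
  by (simp add: C_strictly_convex_def frontier_eq_empty)

lemma B_regular_C_strictly_convex:
  fixes \<Omega> :: "(complex ^ 'n) set"
  assumes "bounded \<Omega>" and conv: "C_strictly_convex \<Omega>"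
  shows "B_regular \<Omega>"
  unfolding B_regular_def
proof (intro conjI allI impI)
  show "open \<Omega>" "connected \<Omega>" "\<Omega> \<noteq> {}" "bounded \<Omega>"
    using assms by (auto simp: C_strictly_convex_def convex_connected)
next
  fix \<phi> :: "complex ^ 'n \<Rightarrow> real" assume \<phi>: "continuous_on (frontier \<Omega>) \<phi>"
  have "\<exists>u. continuous_psh_on UNIV u \<and> (\<forall>z\<in>frontier \<Omega>. \<bar>u z - \<phi> z\<bar> < 1 / real (Suc \<nu>))" for \<nu>
    by (rule psh_approximation [OF assms frontier_nonempty_C_strictly_convex [OF conv] \<phi>]) simp
  then obtain u where u: "\<And>\<nu>. continuous_psh_on UNIV (u \<nu>)"
    "\<And>\<nu> z. z \<in> frontier \<Omega> \<Longrightarrow> \<bar>u \<nu> z - \<phi> z\<bar> < 1 / real (Suc \<nu>)"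
    by metis
  have "uniform_limit (frontier \<Omega>) u \<phi> sequentially"
    unfolding uniform_limit_iff
  proof (intro allI impI)
    fix e :: real assume "e > 0"
    then obtain N where N: "1 / real (Suc N) < e" by (rule nat_approx_posE)
    show "\<forall>\<^sub>F n in sequentially. \<forall>x\<in>frontier \<Omega>. dist (u n x) (\<phi> x) < e"
      using eventually_ge_at_top [of N]
    proof eventually_elim
      case (elim n)
      then have "1 / real (Suc n) \<le> 1 / real (Suc N)" by (simp add: field_simps)
      then show ?case using N by (auto simp: dist_real_def intro: less_trans [OF u(2)])
    qed
  qed
  \<comment> \<open>The approximants are plurisubharmonic on the whole space, so every neighbourhood
    of the frontier can be \<open>UNIV\<close>.\<close>
  then show "\<exists>(u :: nat \<Rightarrow> complex ^ 'n \<Rightarrow> real) U.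
      (\<forall>\<nu>. open (U \<nu>) \<and> frontier \<Omega> \<subseteq> U \<nu> \<and> continuous_psh_on (U \<nu>) (u \<nu>)) \<and>
      uniform_limit (frontier \<Omega>) u \<phi> sequentially"
    using u by (intro exI [of _ u] exI [of _ "\<lambda>_. UNIV"]) auto
qed

section \<open>Consequences of the Schwarz lemma\<close>

text \<open>Disc automorphisms move \<open>a\<close> and \<open>f a\<close> to 0, which reduces the
  claim to the Schwarz lemma.\<close>

lemma Schwarz_Pick:
  assumes f: "f holomorphic_on ball 0 1" "f ` ball 0 1 \<subseteq> ball 0 1"
    and a: "a \<in> ball 0 1" and b: "b \<in> ball 0 1"
  shows "cmod ((f b - f a) / (1 - cnj (f a) * f b)) \<le> cmod ((b - a) / (1 - cnj a * b))"
proof -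
  let ?g = "\<lambda>z. Moebius_function 0 (f a) (f (Moebius_function 0 (- a) z))"
  let ?x = "Moebius_function 0 a b"
  have "f a \<in> ball 0 1" using f(2) a by blast
  then have fa: "cmod (f a) < 1" by simp
  have M: "Moebius_function 0 (- a) ` ball 0 1 \<subseteq> ball 0 1"
    using Moebius_function_norm_lt_1 [of "- a"] a by auto
  have "f \<circ> Moebius_function 0 (- a) holomorphic_on ball 0 1"
    using a by (intro holomorphic_on_compose_gen [OF _ f(1) M] Moebius_function_holomorphic) simp
  then have "Moebius_function 0 (f a) \<circ> (f \<circ> Moebius_function 0 (- a)) holomorphic_on ball 0 1"
    by (rule holomorphic_on_compose_gen [OF _ Moebius_function_holomorphic [OF fa]])
      (use M f(2) in fastforce)
  then have g: "?g holomorphic_on ball 0 1" by (simp add: o_def)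
  have "cmod (?g ?x) \<le> cmod ?x"
  proof (rule Schwarz_Lemma(1) [OF g])
    show "?g 0 = 0" by (simp add: Moebius_function_of_zero Moebius_function_eq_zero)
    show "cmod (?g z) < 1" if "cmod z < 1" for z
    proof -
      have "f (Moebius_function 0 (- a) z) \<in> ball 0 1" using that M f(2) by (simp add: image_subset_iff)
      then show ?thesis using fa by (intro Moebius_function_norm_lt_1) auto
    qed
    show "cmod ?x < 1" using a b by (intro Moebius_function_norm_lt_1) auto
  qed
  moreover have "Moebius_function 0 (- a) ?x = b"
    using a b by (intro Moebius_function_compose) auto
  ultimately show ?thesis by (simp add: Moebius_function_simple)
qed

text \<open>The Schwarz lemma for the Cayley transform \<open>(G - G 0) / (G + cnj (G 0))\<close>.\<close>

lemma deriv_positive_real_part: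
  assumes G: "G holomorphic_on ball 0 1" and pos: "\<And>z. z \<in> ball 0 1 \<Longrightarrow> Re (G z) > 0"
  shows "cmod (deriv G 0) \<le> 2 * Re (G 0)"
proof -
  let ?F = "\<lambda>z. (G z - G 0) / (G z + cnj (G 0))"
  have G0: "Re (G 0) > 0" using pos by simp
  have nz: "G z + cnj (G 0) \<noteq> 0" if "z \<in> ball 0 1" for z
  proof
    assume "G z + cnj (G 0) = 0"
    then have "Re (G z + cnj (G 0)) = 0" by simp
    then show False using pos [OF that] G0 by simp
  qed
  have F: "?F holomorphic_on ball 0 1" using nz by (intro holomorphic_intros G) auto
  have "cmod (?F z) < 1" if z: "cmod z < 1" for z
  proof -
    \<comment> \<open>This product is the difference of the squared moduli of the denominator and
      the numerator of \<open>?F z\<close>.\<close>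
    have "0 < 4 * Re (G z) * Re (G 0)" using pos [of z] z G0 by simp
    then have "(cmod (G z - G 0))\<^sup>2 < (cmod (G z + cnj (G 0)))\<^sup>2"
      unfolding cmod_power2 by (simp add: power2_eq_square algebra_simps)
    then have "cmod (G z - G 0) < cmod (G z + cnj (G 0))"
      by (rule power2_less_imp_less) simp
    then show ?thesis using nz [of z] z by (simp add: norm_divide)
  qed
  then have F': "cmod (deriv ?F 0) \<le> 1"
    using Schwarz_Lemma(2) [OF F, of 0] by simp
  have dG: "(G has_field_derivative deriv G 0) (at 0)"
    using G by (intro holomorphic_derivI [of _ "ball 0 1"]) auto
  have r: "G 0 + cnj (G 0) = 2 * Re (G 0)" by (simp add: complex_add_cnj)
  have "(?F has_field_derivative deriv G 0 / (G 0 + cnj (G 0))) (at 0)"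
  proof -
    have "(?F has_field_derivative ((deriv G 0 - 0) * (G 0 + cnj (G 0)) - (G 0 - G 0) * (deriv G 0 + 0))
        / ((G 0 + cnj (G 0)) * (G 0 + cnj (G 0)))) (at 0)"
      by (intro DERIV_divide DERIV_diff DERIV_add DERIV_const dG nz) simp
    then show ?thesis using nz [of 0] by simp
  qed
  then have "deriv ?F 0 = deriv G 0 / (G 0 + cnj (G 0))" by (rule DERIV_imp_deriv)
  then have "cmod (deriv ?F 0) = cmod (deriv G 0) / (2 * Re (G 0))"
    unfolding r using G0 by (simp add: norm_divide norm_mult)
  with F' have "cmod (deriv G 0) / (2 * Re (G 0)) \<le> 1" by simp
  then show ?thesis using G0 by (simp add: pos_divide_le_eq)
qed

text \<open>For a convex target, holomorphic discs may be replaced by affine ones at the cost of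
  a factor 2: otherwise a separating functional contradicts \<open>deriv_positive_real_part\<close>.\<close>

lemma affine_disc_subset_convex:
  fixes \<Omega> :: "(complex ^ 'n) set"
  assumes \<Omega>: "open \<Omega>" "convex \<Omega>" and \<psi>: "\<psi> \<in> hol_discs \<Omega>" and \<zeta>: "\<zeta> \<in> ball 0 1"
    and c: "2 * cmod c < 1 - cmod \<zeta>"
  shows "\<psi> \<zeta> + c *s (\<chi> i. deriv (\<lambda>x. \<psi> x $ i) \<zeta>) \<in> \<Omega>"
proof (rule ccontr)
  let ?D = "(\<chi> i. deriv (\<lambda>x. \<psi> x $ i) \<zeta>) :: complex ^ 'n"
  let ?s = "1 - cmod \<zeta>"
  have hol: "(\<lambda>x. \<psi> x $ i) holomorphic_on ball 0 1" and im: "\<psi> ` ball 0 1 \<subseteq> \<Omega>" for i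
    using \<psi> by (auto simp: hol_discs_def)
  have s: "?s > 0" using \<zeta> by simp
  assume "\<psi> \<zeta> + c *s ?D \<notin> \<Omega>"
  moreover have "\<Omega> \<noteq> {}" using im \<zeta> by auto
  ultimately obtain a \<beta> where a: "a \<noteq> 0" "\<And>x. x \<in> \<Omega> \<Longrightarrow> a \<bullet> x \<le> \<beta>" "\<beta> \<le> a \<bullet> (\<psi> \<zeta> + c *s ?D)"
    using separating_hyperplane_sets [of \<Omega> "{\<psi> \<zeta> + c *s ?D}"] \<Omega>(2) by auto
  \<comment> \<open>Openness makes the separation strict: a small move from \<open>x\<close> in
    direction \<open>a\<close> stays in \<open>\<Omega>\<close>. Strictness is what makes
    \<open>Re (G z)\<close> positive.\<close>
  have less: "a \<bullet> x < \<beta>" if x: "x \<in> \<Omega>" for x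
  proof -
    obtain e where e: "e > 0" "cball x e \<subseteq> \<Omega>" using \<Omega>(1) x open_contains_cball by blast
    have "x + (e / norm a) *\<^sub>R a \<in> \<Omega>" using e a(1) by (intro subsetD [OF e(2)]) (simp add: dist_norm)
    then have "a \<bullet> x + (e / norm a) * (a \<bullet> a) \<le> \<beta>" using a(2) by (fastforce simp: inner_add)
    moreover have "(e / norm a) * (a \<bullet> a) > 0" using e a(1) by simp
    ultimately show ?thesis by linarith
  qed
  have inb: "\<zeta> + of_real ?s * z \<in> ball 0 1" if "z \<in> ball 0 1" for z
  proof -
    have "cmod (\<zeta> + of_real ?s * z) \<le> cmod \<zeta> + ?s * cmod z"
      using norm_triangle_ineq [of \<zeta> "of_real ?s * z"] s by (simp add: norm_mult del: of_real_diff)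
    also have "\<dots> < cmod \<zeta> + ?s * 1"
      using that s by (intro add_strict_left_mono mult_strict_left_mono) auto
    finally show ?thesis by simp
  qed
  \<comment> \<open>The disc of radius \<open>?s\<close> about \<open>\<zeta>\<close> is rescaled to
    the unit disc; the chain rule puts the factor \<open>?s\<close> into the derivative at
    0.\<close>
  define G where "G z = of_real \<beta> - hprod a (\<psi> (\<zeta> + of_real ?s * z))" for z
  have comp: "(\<lambda>z. \<psi> (\<zeta> + of_real ?s * z) $ i) holomorphic_on ball 0 1" for i
    using holomorphic_on_compose_gen [of "\<lambda>z. \<zeta> + of_real ?s * z" "ball 0 1", OF _ hol [of i]] inb
    by (force simp: o_def intro: holomorphic_intros)
  have G: "G holomorphic_on ball 0 1"
    unfolding G_def hprod_def by (intro holomorphic_intros comp)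
  have pos: "Re (G z) > 0" if "z \<in> ball 0 1" for z
  proof -
    have "\<psi> (\<zeta> + of_real ?s * z) \<in> \<Omega>" using inb [OF that] im by auto
    then show ?thesis unfolding G_def using less by (simp add: Re_hprod)
  qed
  have d\<psi>: "((\<lambda>x. \<psi> x $ i) has_field_derivative ?D $ i) (at \<zeta>)" for i
    using holomorphic_derivI [OF hol _ \<zeta>] by simp
  have "((\<lambda>z. \<psi> (\<zeta> + of_real ?s * z) $ i) has_field_derivative ?D $ i * of_real ?s) (at 0)" for i
    using d\<psi> [of i] by (intro DERIV_chain2 [where f = "\<lambda>x. \<psi> x $ i"]) (auto intro!: derivative_eq_intros)
  then have "(G has_field_derivative (0 - (\<Sum>i\<in>UNIV. cnj (a $ i) * (?D $ i * of_real ?s)))) (at 0)"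
    unfolding G_def hprod_def
    by (intro DERIV_diff DERIV_const DERIV_sum DERIV_cmult)
  then have "deriv G 0 = 0 - (\<Sum>i\<in>UNIV. cnj (a $ i) * (?D $ i * of_real ?s))"
    by (rule DERIV_imp_deriv)
  also have "\<dots> = - of_real ?s * hprod a ?D"
    unfolding hprod_def by (simp add: sum_distrib_left mult_ac flip: sum_negf del: of_real_diff vec_lambda_beta)
  finally have "deriv G 0 = - of_real ?s * hprod a ?D" .
  then have "?s * cmod (hprod a ?D) \<le> 2 * Re (G 0)"
    using deriv_positive_real_part [OF G pos]
    by (simp only: norm_mult norm_minus_cancel norm_of_real abs_of_pos [OF s])
  moreover have "Re (G 0) > 0" using pos by simp
  \<comment> \<open>Strictness has two sources: the bound on \<open>c\<close> if
    \<open>hprod a ?D\<close> is nonzero, and \<open>Re (G 0) > 0\<close> otherwise.\<close>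
  ultimately have "2 * cmod c * cmod (hprod a ?D) < 2 * Re (G 0)"
  proof (cases "hprod a ?D = 0")
    case False
    then have "2 * cmod c * cmod (hprod a ?D) < ?s * cmod (hprod a ?D)"
      using c by (intro mult_strict_right_mono) auto
    also have "\<dots> \<le> 2 * Re (G 0)" by fact
    finally show ?thesis .
  qed simp
  moreover have "a \<bullet> (c *s ?D) \<le> cmod c * cmod (hprod a ?D)"
    using complex_Re_le_cmod [of "c * hprod a ?D"]
    by (simp only: Re_hprod [symmetric] hprod_scale norm_mult)
  moreover have "Re (G 0) = \<beta> - a \<bullet> \<psi> \<zeta>" by (simp add: G_def Re_hprod)
  ultimately show False using a(3) by (simp add: inner_add)
qed

section \<open>Kobayashi distances\<close>

lemma artanh_real_nonneg: "0 \<le> x \<Longrightarrow> x < 1 \<Longrightarrow> 0 \<le> artanh (x :: real)"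
  by (simp add: artanh_def field_simps)

lemma poincare_dist_nonneg:
  assumes "a \<in> ball 0 1" "b \<in> ball 0 1"
  shows "0 \<le> poincare_dist a b"
  unfolding poincare_dist_def using Moebius_function_norm_lt_1 [of b a 0] assms
  by (intro artanh_real_nonneg) (auto simp: Moebius_function_simple)

text \<open>For fixed moduli the pseudohyperbolic distance is least when both points lie on one ray
  from 0, where \<open>Re (cnj z * w)\<close> reaches its maximum
  \<open>cmod z * cmod w\<close>.\<close>

lemma pseudo_hyperbolic_ge:
  assumes "cmod z < 1" "cmod w < 1"
  shows "\<bar>cmod w - cmod z\<bar> / (1 - cmod w * cmod z) \<le> cmod ((w - z) / (1 - cnj z * w))"
proof -
  define x y t where "x = cmod w" and "y = cmod z" and "t = Re (cnj z * w)"
  have xy: "0 \<le> x" "x < 1" "0 \<le> y" "y < 1" using assms by (auto simp: x_def y_def)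
  then have "x * y < 1 * 1" by (intro mult_strict_mono) auto
  then have d: "1 - x * y > 0" by simp
  have "t \<le> x * y"
    using complex_Re_le_cmod [of "cnj z * w"] by (simp add: t_def x_def y_def norm_mult mult.commute)
  have nz: "cmod (1 - cnj z * w) > 0"
  proof -
    have "cmod (cnj z * w) < 1" using d by (simp add: x_def y_def norm_mult mult.commute)
    then have "cnj z * w \<noteq> 1" by auto
    then show ?thesis by simp
  qed
  have A: "(cmod (w - z))\<^sup>2 = x\<^sup>2 + y\<^sup>2 - 2 * t"
    unfolding x_def y_def t_def cmod_power2 by (simp add: power2_eq_square algebra_simps)
  have B: "(cmod (1 - cnj z * w))\<^sup>2 = 1 + x\<^sup>2 * y\<^sup>2 - 2 * t"
    unfolding x_def y_def t_def cmod_power2 by (simp add: power2_eq_square algebra_simps)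
  \<comment> \<open>The squared claim, cleared of denominators, is affine in \<open>t\<close> with
    equality at \<open>t = x * y\<close>; this product is the difference of its two sides.\<close>
  have "0 \<le> 2 * (x * y - t) * ((1 - x\<^sup>2) * (1 - y\<^sup>2))"
    using \<open>t \<le> x * y\<close> xy by (intro mult_nonneg_nonneg) (auto simp: power_le_one)
  also have "\<dots> = (x\<^sup>2 + y\<^sup>2 - 2 * t) * (1 - x * y)\<^sup>2 - (x - y)\<^sup>2 * (1 + x\<^sup>2 * y\<^sup>2 - 2 * t)"
    by (simp add: power2_eq_square algebra_simps)
  finally have "(\<bar>x - y\<bar> * cmod (1 - cnj z * w))\<^sup>2 \<le> (cmod (w - z) * (1 - x * y))\<^sup>2"
    by (simp add: power_mult_distrib A B)
  then have "\<bar>x - y\<bar> * cmod (1 - cnj z * w) \<le> cmod (w - z) * (1 - x * y)"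
    by (rule power2_le_imp_le) (use d in simp)
  then show ?thesis
    using d nz by (simp add: norm_divide field_simps x_def [symmetric] y_def [symmetric])
qed

text \<open>The last hypothesis is \<open>x \<le> (y + r) / (1 + y * r)\<close> cleared of its
  denominator, that is, the addition formula for \<open>tanh\<close>.\<close>

lemma artanh_add_ge:
  fixes x y r :: real
  assumes "0 \<le> x" "x < 1" "0 \<le> y" "y < 1" "0 \<le> r" "r < 1" "x - y \<le> r * (1 - x * y)"
  shows "artanh x \<le> artanh y + artanh r"
proof -
  have "(1 + x) / (1 - x) \<le> (1 + y) / (1 - y) * ((1 + r) / (1 - r))"
  proof -
    have "(1 + x) * ((1 - y) * (1 - r)) \<le> (1 + y) * (1 + r) * (1 - x)"
      using assms(7) by (simp add: algebra_simps)
    moreover have "1 - x > 0" "(1 - y) * (1 - r) > 0" using assms by auto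
    ultimately show ?thesis
      unfolding times_divide_times_eq by (simp only: pos_divide_le_eq pos_le_divide_eq times_divide_eq_left)
  qed
  then have "ln ((1 + x) / (1 - x)) \<le> ln ((1 + y) / (1 - y) * ((1 + r) / (1 - r)))"
    using assms by (subst ln_le_cancel_iff) auto
  also have "\<dots> = ln ((1 + y) / (1 - y)) + ln ((1 + r) / (1 - r))"
    using assms by (intro ln_mult_pos) auto
  finally show ?thesis by (simp add: artanh_def)
qed

lemma artanh_norm_image_le:
  assumes f: "f holomorphic_on ball 0 1" "f ` ball 0 1 \<subseteq> ball 0 1"
    and a: "a \<in> ball 0 1" and b: "b \<in> ball 0 1"
  shows "artanh (cmod (f b)) \<le> artanh (cmod (f a)) + poincare_dist a b"
proof -
  have "f a \<in> ball 0 1" "f b \<in> ball 0 1" using f(2) a b by blast+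
  then have fab: "cmod (f a) < 1" "cmod (f b) < 1" by auto
  let ?r = "cmod ((a - b) / (1 - cnj b * a))"
  have "\<bar>cmod (f a) - cmod (f b)\<bar> / (1 - cmod (f a) * cmod (f b)) \<le> ?r"
    by (rule order_trans [OF pseudo_hyperbolic_ge Schwarz_Pick [OF f b a]]) fact+
  moreover have "cmod (f a) * cmod (f b) < 1 * 1" using fab by (intro mult_strict_mono) auto
  ultimately have "\<bar>cmod (f a) - cmod (f b)\<bar> \<le> ?r * (1 - cmod (f a) * cmod (f b))"
    by (simp add: pos_divide_le_eq)
  then have "cmod (f b) - cmod (f a) \<le> ?r * (1 - cmod (f b) * cmod (f a))"
    by (simp add: mult.commute)
  moreover have "?r < 1"
    using Moebius_function_norm_lt_1 [of b a 0] a b by (simp add: Moebius_function_simple)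
  ultimately show ?thesis unfolding poincare_dist_def using fab by (intro artanh_add_ge) auto
qed

text \<open>\<open>artanh (cmod _)\<close> vanishes at 0 and, by
  \<open>artanh_norm_image_le\<close>, grows along each link by at most the length of that link;
  this telescopes over every chain from 0 to \<open>z\<close>.\<close>

lemma kobayashi_dist_disc_ge:
  assumes "z \<in> ball 0 1"
  shows "artanh (cmod z) \<le> kobayashi_dist_disc 0 z"
  unfolding kobayashi_dist_disc_def chain_dist_def
proof (rule cInf_greatest)
  let ?F = "{f. f holomorphic_on ball 0 1 \<and> f ` ball 0 1 \<subseteq> ball 0 (1::real)} :: (complex \<Rightarrow> complex) set"
  let ?S = "{(\<Sum>i<m. poincare_dist (a i) (b i)) | m a b.
     \<exists>p f. p 0 = 0 \<and> p m = z \<and> (\<forall>i<m. f i \<in> ?F \<and> a i \<in> ball 0 1 \<and> b i \<in> ball 0 1 \<and>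
              f i (a i) = p i \<and> f i (b i) = p (Suc i))}"
  have "(\<Sum>i<Suc 0. poincare_dist 0 z) \<in> ?S"
    using assms
    by (intro CollectI exI [of _ "Suc 0"] exI [of _ "\<lambda>_. 0"] exI [of _ "\<lambda>_. z"] conjI refl
        exI [of _ "\<lambda>i. if i = 0 then 0 else z"] exI [of _ "\<lambda>_ z. z"]) auto
  then show "?S \<noteq> {}" by blast
  fix x assume "x \<in> ?S"
  then obtain m a b p f where x: "x = (\<Sum>i<m. poincare_dist (a i) (b i))"
    and p: "p 0 = 0" "p m = z" and f: "\<And>i. i < m \<Longrightarrow> f i \<in> ?F \<and> a i \<in> ball 0 1 \<and> b i \<in> ball 0 1 \<and>
              f i (a i) = p i \<and> f i (b i) = p (Suc i)"
    by blast
  have "artanh (cmod (p k)) \<le> (\<Sum>i<k. poincare_dist (a i) (b i))" if "k \<le> m" for k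
    using that
  proof (induction k)
    case (Suc k)
    then have "artanh (cmod (p (Suc k))) \<le> artanh (cmod (p k)) + poincare_dist (a k) (b k)"
      using artanh_norm_image_le [of "f k" "a k" "b k"] f [of k] by auto
    then show ?case using Suc by simp
  qed (simp add: p)
  from this [of m] show "artanh (cmod z) \<le> x" by (simp add: p x)
qed

section \<open>Upper bound for the Kobayashi distance in convex domains\<close>

lemma kobayashi_dist_le_chain:
  assumes "p 0 = z" "p m = w" and disc: "\<And>i x. i < m \<Longrightarrow> cmod x < 1 \<Longrightarrow> p i + (2 * x) *s (p (Suc i) - p i) \<in> \<Omega>"
  shows "kobayashi_dist \<Omega> z w \<le> real m * artanh (1 / 2)"
proof -
  let ?S = "{(\<Sum>i<m. poincare_dist (a i) (b i)) | m a b.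
     \<exists>p f. p 0 = z \<and> p m = w \<and> (\<forall>i<m. f i \<in> hol_discs \<Omega> \<and> a i \<in> ball 0 1 \<and> b i \<in> ball 0 1 \<and>
              f i (a i) = p i \<and> f i (b i) = p (Suc i))}"
  have "bdd_below ?S"
    by (rule bdd_belowI [of _ 0]) (auto intro!: sum_nonneg poincare_dist_nonneg)
  moreover have "(\<Sum>i<m. poincare_dist 0 (1 / 2)) \<in> ?S"
  proof -
    \<comment> \<open>The parametrization reaches the next point at \<open>1 / 2\<close>, so every
      link costs \<open>artanh (1 / 2)\<close>.\<close>
    let ?f = "\<lambda>i x. p i + (2 * x) *s (p (Suc i) - p i)"
    have "?f i \<in> hol_discs \<Omega> \<and> (0::complex) \<in> ball 0 1 \<and> (1 / 2::complex) \<in> ball 0 1 \<and>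
        ?f i 0 = p i \<and> ?f i (1 / 2) = p (Suc i)" if i: "i < m" for i
      using disc [OF i] by (auto simp: hol_discs_def vec_eq_iff intro!: holomorphic_intros)
    then have "\<exists>p f. p 0 = z \<and> p m = w \<and> (\<forall>i<m. f i \<in> hol_discs \<Omega> \<and> (0::complex) \<in> ball 0 1 \<and>
        (1 / 2::complex) \<in> ball 0 1 \<and> f i 0 = p i \<and> f i (1 / 2) = p (Suc i))"
      using assms(1,2) by (intro exI [of _ p] exI [of _ ?f]) auto
    then show ?thesis
      by (intro CollectI exI [of _ m]) (rule exI [of _ "\<lambda>_. 0"], rule exI [of _ "\<lambda>_. 1 / 2"], simp)
  qed
  ultimately have "kobayashi_dist \<Omega> z w \<le> (\<Sum>i<m. poincare_dist 0 (1 / 2))"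
    unfolding kobayashi_dist_def chain_dist_def by (rule cInf_lower [rotated])
  then show ?thesis by (simp add: poincare_dist_def norm_divide)
qed

text \<open>The chain follows the segment from \<open>z0\<close> to \<open>z\<close>, shrinking the
  remaining distance by the factor \<open>l\<close> in each of \<open>m\<close> links, and a last
  link jumps to \<open>z\<close> inside the ball about \<open>z\<close>.\<close>

lemma kobayashi_dist_convex_le:
  fixes \<Omega> :: "(complex ^ 'n) set"
  assumes conv: "convex \<Omega>" and z: "z \<in> \<Omega>" and R: "ball z0 R \<subseteq> \<Omega>" and d: "ball z d \<subseteq> \<Omega>"
    and l: "0 < l" "l \<le> 1" "2 * (1 - l) * norm (z0 - z) < R" and m: "3 * l ^ m * norm (z0 - z) < d"
  shows "kobayashi_dist \<Omega> z0 z \<le> real (Suc m) * artanh (1 / 2)"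
proof -
  define p where "p i = (if i \<le> m then z + (of_real (l ^ i)) *s (z0 - z) else z)" for i
  show ?thesis
  proof (rule kobayashi_dist_le_chain [of p])
    show "p 0 = z0" "p (Suc m) = z" by (simp_all add: p_def)
    fix i x assume i: "i < Suc m" and x: "cmod x < 1"
    show "p i + (2 * x) *s (p (Suc i) - p i) \<in> \<Omega>"
    proof (cases "i < m")
      case True
      \<comment> \<open>The disc of link \<open>i\<close> is the image of a disc in the ball about
        \<open>z0\<close> under the homothety with centre \<open>z\<close> and ratio
        \<open>l ^ i\<close>, so convexity keeps it in \<open>\<Omega>\<close>.\<close>
      define v where "v = (2 * x * of_real (l - 1)) *s (z0 - z)"
      let ?y = "z0 + v"
      have "cmod (2 * x * of_real (l - 1)) \<le> 2 * (1 - l)"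
        using x l mult_right_mono [of "cmod x" 1 "1 - l"] by (simp only: norm_mult norm_of_real) simp
      then have "norm v \<le> 2 * (1 - l) * norm (z0 - z)"
        unfolding v_def norm_vector_scalar_mult by (intro mult_right_mono) auto
      then have "?y \<in> \<Omega>"
        using l(3) by (intro subsetD [OF R]) (simp add: dist_norm)
      then have "(1 - l ^ i) *\<^sub>R z + l ^ i *\<^sub>R ?y \<in> \<Omega>"
        using l by (intro convexD [OF conv z]) (auto simp: power_le_one)
      also have "(1 - l ^ i) *\<^sub>R z + l ^ i *\<^sub>R ?y = p i + (2 * x) *s (p (Suc i) - p i)"
        using True by (simp add: p_def v_def vec_eq_iff scaleR_conv_of_real [where 'a = complex] algebra_simps)
      finally show ?thesis .
    next
      case False
      then have i: "i = m" using i by simp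
      \<comment> \<open>Since \<open>cmod (1 - 2 * x) \<le> 3\<close>, the last disc fits; this is
        the source of the constant 3.\<close>
      define v where "v = ((1 - 2 * x) * of_real (l ^ m)) *s (z0 - z)"
      have "p i + (2 * x) *s (p (Suc i) - p i) = z + v"
        by (simp add: p_def v_def vec_eq_iff i algebra_simps)
      moreover have "cmod ((1 - 2 * x) * of_real (l ^ m)) \<le> 3 * l ^ m"
        using norm_triangle_ineq4 [of 1 "2 * x"] x l
        by (simp add: norm_mult norm_power mult_right_mono)
      then have "norm v < d"
        unfolding v_def norm_vector_scalar_mult using m
        by (meson le_less_trans mult_right_mono norm_ge_zero)
      then have "z + v \<in> \<Omega>" by (intro subsetD [OF d]) (simp add: dist_norm)
      ultimately show ?thesis by simp
    qed
  qed
qed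

text \<open>\<open>artanh (1 / 2)\<close> equals \<open>ln 3 / 2\<close>, which is why powers of
  \<open>1 / 3\<close> serve as the scale for \<open>1 - r\<close>.\<close>

lemma artanh_gt:
  assumes "0 \<le> r" "r < 1" "1 - r < (1 / 3) ^ k"
  shows "real k * artanh (1 / 2) < artanh (r :: real)"
proof -
  have "3 ^ k * (1 - r) < 3 ^ k * (1 / 3) ^ k" using assms by (intro mult_strict_left_mono) auto
  then have "3 ^ k < 1 / (1 - r)" using assms by (simp add: pos_less_divide_eq power_one_over)
  also have "\<dots> \<le> (1 + r) / (1 - r)" using assms by (intro divide_right_mono) auto
  finally have "ln (3 ^ k) < ln ((1 + r) / (1 - r))" using assms by (subst ln_less_cancel_iff) auto
  then show ?thesis using assms by (simp add: artanh_def ln_realpow)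
qed

text \<open>A larger ball about \<open>\<psi> \<zeta>\<close> would allow a chain of
  \<open>Suc m\<close> links from \<open>\<psi> 0\<close>, of total length below
  \<open>artanh (cmod \<zeta>)\<close>, against the isometry property.\<close>

lemma geodesic_boundary_distance:
  fixes \<Omega> :: "(complex ^ 'n) set"
  assumes \<Omega>: "open \<Omega>" "convex \<Omega>" "bounded \<Omega>" and \<psi>: "complex_geodesic \<Omega> \<psi>"
  obtains l C where "0 < l" "l < 1" "C > 0"
    "\<And>m \<zeta> d. \<zeta> \<in> ball 0 1 \<Longrightarrow> 1 - cmod \<zeta> < (1 / 3) ^ Suc m \<Longrightarrow> ball (\<psi> \<zeta>) d \<subseteq> \<Omega> \<Longrightarrow> d \<le> C * l ^ m"
proof -
  have im: "\<psi> ` ball 0 1 \<subseteq> \<Omega>" using \<psi> by (auto simp: complex_geodesic_def hol_discs_def)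
  then have z0: "\<psi> 0 \<in> \<Omega>" by auto
  then obtain R where R: "R > 0" "ball (\<psi> 0) R \<subseteq> \<Omega>" using \<Omega>(1) open_contains_ball by blast
  obtain D where D: "D > 0" "\<And>z. z \<in> \<Omega> \<Longrightarrow> norm (\<psi> 0 - z) \<le> D"
  proof -
    obtain B where "B > 0" "\<And>z. z \<in> \<Omega> \<Longrightarrow> norm z \<le> B" using \<Omega>(3) unfolding bounded_pos by blast
    then show ?thesis using that [of "B + B"] z0
      by (meson add_mono add_pos_pos norm_triangle_ineq4 order_trans)
  qed
  \<comment> \<open>This gives \<open>2 * (1 - l) * D \<le> R / 2\<close>, so the early links fit
    into the ball about \<open>\<psi> 0\<close>; the minimum with \<open>1 / 2\<close> keeps
    \<open>l\<close> positive.\<close>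
  define l where "l = 1 - min (1 / 2) (R / (4 * D))"
  have l: "0 < l" "l < 1" using R D by (auto simp: l_def min_def)
  have "1 - l \<le> R / (4 * D)" by (simp add: l_def)
  then have lR: "2 * (1 - l) * D < R" using R D by (simp add: field_simps)
  show ?thesis
  proof (rule that [of l "3 * D"])
    fix m \<zeta> d
    assume \<zeta>: "\<zeta> \<in> ball 0 1" and m: "1 - cmod \<zeta> < (1 / 3) ^ Suc m" and d: "ball (\<psi> \<zeta>) d \<subseteq> \<Omega>"
    have z: "\<psi> \<zeta> \<in> \<Omega>" using im \<zeta> by auto
    show "d \<le> 3 * D * l ^ m"
    proof (rule ccontr)
      assume "\<not> d \<le> 3 * D * l ^ m"
      moreover have "l ^ m * norm (\<psi> 0 - \<psi> \<zeta>) \<le> l ^ m * D" using D z l by (intro mult_left_mono) auto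
      ultimately have "3 * l ^ m * norm (\<psi> 0 - \<psi> \<zeta>) < d" by (simp add: mult_ac)
      moreover have "2 * (1 - l) * norm (\<psi> 0 - \<psi> \<zeta>) < R"
        using D(2) [OF z] l by (intro le_less_trans [OF mult_left_mono lR]) auto
      ultimately have "kobayashi_dist \<Omega> (\<psi> 0) (\<psi> \<zeta>) \<le> real (Suc m) * artanh (1 / 2)"
        using kobayashi_dist_convex_le [OF \<Omega>(2) z R(2) d] l by simp
      also have "\<dots> < artanh (cmod \<zeta>)" using \<zeta> m by (intro artanh_gt) auto
      also have "\<dots> \<le> kobayashi_dist \<Omega> (\<psi> 0) (\<psi> \<zeta>)"
        using kobayashi_dist_disc_ge [OF \<zeta>] \<psi> \<zeta> by (simp add: complex_geodesic_def)
      finally show False by simp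
    qed
  qed (use l D in auto)
qed

section \<open>The canonical function along geodesics\<close>

text \<open>The squared norm has circle mean \<open>(norm p)\<^sup>2 + (norm b)\<^sup>2\<close>;
  averaging \<open>u z \<le> M - 2 * (norm z)\<^sup>2\<close> therefore gains the term in
  \<open>b\<close>.\<close>

lemma psh_plus_norm_sub_mean:
  fixes u :: "complex ^ 'n \<Rightarrow> real"
  assumes u: "continuous_psh_on \<Omega> u" and disc: "\<And>\<zeta>. \<zeta> \<in> cball 0 1 \<Longrightarrow> p + \<zeta> *s b \<in> \<Omega>"
    and M: "\<And>z. z \<in> \<Omega> \<Longrightarrow> u z + 2 * (norm z)\<^sup>2 \<le> M"
  shows "u p + 2 * (norm p)\<^sup>2 + 2 * (norm b)\<^sup>2 \<le> M"
proof -
  have "((\<lambda>\<theta>. Re (of_real (2 * ((norm p)\<^sup>2 + (norm b)\<^sup>2)) + 4 * hprod p b * cis \<theta> + 0 * (cis \<theta>)\<^sup>2))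
      has_integral 2 * pi * Re (of_real (2 * ((norm p)\<^sup>2 + (norm b)\<^sup>2)))) {0..2 * pi}"
    by (rule has_integral_circle_quadratic)
  then have "((\<lambda>\<theta>. 2 * (norm (p + cis \<theta> *s b))\<^sup>2) has_integral 2 * pi * (2 * ((norm p)\<^sup>2 + (norm b)\<^sup>2))) {0..2 * pi}"
    by (simp add: norm_add_cis_scale algebra_simps)
  from has_integral_diff [OF has_integral_const_real [of M 0 "2 * pi"] this]
  have "((\<lambda>\<theta>. M - 2 * (norm (p + cis \<theta> *s b))\<^sup>2) has_integral
      2 * pi * (M - 2 * ((norm p)\<^sup>2 + (norm b)\<^sup>2))) {0..2 * pi}"
    by (simp add: algebra_simps)
  moreover have "((\<lambda>\<theta>. u (p + cis \<theta> *s b)) has_integral integral {0..2 * pi} (\<lambda>\<theta>. u (p + cis \<theta> *s b))) {0..2 * pi}"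
    using u disc unfolding continuous_psh_on_def
    by (intro integrable_integral integrable_on_circle [of \<Omega> u]) auto
  ultimately have "integral {0..2 * pi} (\<lambda>\<theta>. u (p + cis \<theta> *s b)) \<le> 2 * pi * (M - 2 * ((norm p)\<^sup>2 + (norm b)\<^sup>2))"
    using M disc by (elim has_integral_le [rotated]) (force simp: algebra_simps)
  then have "integral {0..2 * pi} (\<lambda>\<theta>. u (p + cis \<theta> *s b)) / (2 * pi) \<le> M - 2 * ((norm p)\<^sup>2 + (norm b)\<^sup>2)"
    by (simp add: field_simps)
  moreover have "u p \<le> integral {0..2 * pi} (\<lambda>\<theta>. u (p + cis \<theta> *s b)) / (2 * pi)"
    using u disc unfolding continuous_psh_on_def by blast
  ultimately show ?thesis by simp
qed

text \<open>Maximum principle: at an interior maximum \<open>psh_plus_norm_sub_mean\<close> would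
  force \<open>b = 0\<close> for every small disc, so the maximum sits on the frontier, where the
  function vanishes.\<close>

lemma canonical_function_le:
  fixes \<Omega> :: "(complex ^ 'n) set"
  assumes \<Omega>: "open \<Omega>" "bounded \<Omega>" and u: "is_canonical_function \<Omega> u" and z: "z \<in> closure \<Omega>"
  shows "u z + 2 * (norm z)\<^sup>2 \<le> 0"
proof -
  let ?v = "\<lambda>z. u z + 2 * (norm z)\<^sup>2"
  have c: "continuous_on (closure \<Omega>) ?v"
    using u unfolding is_canonical_function_def by (intro continuous_intros) auto
  have k: "compact (closure \<Omega>)" "closure \<Omega> \<noteq> {}" using \<Omega> z by auto
  obtain x where x: "x \<in> closure \<Omega>" "\<And>y. y \<in> closure \<Omega> \<Longrightarrow> ?v y \<le> ?v x"
    using continuous_attains_sup [OF k c] by blast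
  have "x \<notin> \<Omega>"
  proof
    assume "x \<in> \<Omega>"
    then obtain e where e: "e > 0" "cball x e \<subseteq> \<Omega>" using \<Omega>(1) open_contains_cball by blast
    \<comment> \<open>\<open>undefined\<close> is an arbitrary coordinate index; any vector of norm
      \<open>e\<close> would serve.\<close>
    define b :: "complex ^ 'n" where "b = of_real e *s axis undefined 1"
    have b: "norm b = e" using e by (simp add: b_def norm_vector_scalar_mult)
    have "?v x + 2 * (norm b)\<^sup>2 \<le> ?v x"
    proof (rule psh_plus_norm_sub_mean)
      show "continuous_psh_on \<Omega> u" using u by (simp add: is_canonical_function_def)
      show "?v y \<le> ?v x" if "y \<in> \<Omega>" for y using x(2) that closure_subset by blast
      fix \<zeta> :: complex assume "\<zeta> \<in> cball 0 1"
      then have "norm (\<zeta> *s b) \<le> e" using e by (simp add: norm_vector_scalar_mult b mult_left_le_one_le)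
      then show "x + \<zeta> *s b \<in> \<Omega>" by (intro subsetD [OF e(2)]) (simp add: dist_norm)
    qed
    then show False using b e by simp
  qed
  then have "x \<in> frontier \<Omega>" using x(1) \<Omega>(1) by (simp add: frontier_def interior_open)
  then have "?v x = 0" using u by (simp add: is_canonical_function_def)
  then show ?thesis using x(2) [OF z] by simp
qed

lemma norm_deriv_disc_le:
  fixes \<Omega> :: "(complex ^ 'n) set"
  assumes \<Omega>: "open \<Omega>" "convex \<Omega>" "bounded \<Omega>" and u: "is_canonical_function \<Omega> u"
    and \<psi>: "\<psi> \<in> hol_discs \<Omega>" and \<zeta>: "\<zeta> \<in> ball 0 1"
  shows "norm (\<chi> i. deriv (\<lambda>x. \<psi> x $ i) \<zeta>) * (1 - cmod \<zeta>)
    \<le> 3 * sqrt (- (u (\<psi> \<zeta>) + 2 * (norm (\<psi> \<zeta>))\<^sup>2))"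
proof -
  let ?D = "(\<chi> i. deriv (\<lambda>x. \<psi> x $ i) \<zeta>) :: complex ^ 'n"
  \<comment> \<open>A third rather than a half secures the strict inequality in
    \<open>affine_disc_subset_convex\<close> up to the boundary of the disc.\<close>
  let ?s = "(1 - cmod \<zeta>) / 3"
  let ?v = "\<lambda>z. u z + 2 * (norm z)\<^sup>2"
  have s: "?s > 0" using \<zeta> by simp
  have "?v (\<psi> \<zeta>) + 2 * (norm (of_real ?s *s ?D))\<^sup>2 \<le> 0"
  proof (rule psh_plus_norm_sub_mean)
    show "continuous_psh_on \<Omega> u" using u by (simp add: is_canonical_function_def)
    show "?v y \<le> 0" if "y \<in> \<Omega>" for y
      using canonical_function_le [OF \<Omega>(1,3) u] that closure_subset by blast
    fix \<xi> :: complex assume \<xi>: "\<xi> \<in> cball 0 1"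
    have "2 * cmod (\<xi> * of_real ?s) = 2 * (cmod \<xi> * ?s)" using s by (simp add: norm_mult del: of_real_divide)
    also have "\<dots> \<le> 2 * (1 * ?s)" using \<xi> s by (intro mult_left_mono mult_right_mono) auto
    also have "\<dots> < 1 - cmod \<zeta>" using s by simp
    finally show "\<psi> \<zeta> + \<xi> *s (of_real ?s *s ?D) \<in> \<Omega>"
      unfolding vector_smult_assoc by (rule affine_disc_subset_convex [OF \<Omega>(1,2) \<psi> \<zeta>])
  qed
  moreover have "norm (of_real ?s *s ?D) = ?s * norm ?D"
    using s by (simp add: norm_vector_scalar_mult del: of_real_divide)
  ultimately have "?v (\<psi> \<zeta>) + 2 * (?s * norm ?D)\<^sup>2 \<le> 0" by (simp only:)
  then have "(?s * norm ?D)\<^sup>2 \<le> - ?v (\<psi> \<zeta>)"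
    using zero_le_power2 [of "?s * norm ?D"] by linarith
  then have "?s * norm ?D \<le> sqrt (- ?v (\<psi> \<zeta>))" by (rule real_le_rsqrt)
  then have "3 * (?s * norm ?D) \<le> 3 * sqrt (- ?v (\<psi> \<zeta>))" by (rule mult_left_mono) simp
  moreover have "3 * (?s * norm ?D) = norm ?D * (1 - cmod \<zeta>)" by simp
  ultimately show ?thesis by (simp only:)
qed

text \<open>Integral test on geometric intervals: between \<open>C * l ^ Suc m\<close> and
  \<open>C * l ^ m\<close> the integrand is at least \<open>h (C * l ^ Suc m) / (C * l ^ m)\<close>,
  which times the length of the interval is \<open>(1 - l) * h (C * l ^ Suc m)\<close>.\<close>

lemma summable_Dini:
  fixes h :: "real \<Rightarrow> real"
  assumes mono: "mono_on {0..} h" and pos: "\<And>x. 0 \<le> x \<Longrightarrow> 0 \<le> h x" and Dini: "Dini h"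
    and l: "0 < l" "l < 1" and C: "0 < C"
  shows "summable (\<lambda>m. h (C * l ^ m))"
proof -
  define A where "A m = {C * l ^ Suc m <..< C * l ^ m}" for m
  define c where "c m = h (C * l ^ Suc m) / (C * l ^ m)" for m
  let ?I = "\<integral>\<^sup>+ x \<in> {0<..<C}. ennreal (h x / x) \<partial>lborel"
  have c: "0 \<le> c m" for m using pos l C by (simp add: c_def)
  have fin: "?I < \<infinity>" using Dini C by (simp add: Dini_def)
  \<comment> \<open>The intervals are disjoint, so at each point at most one summand
    survives.\<close>
  have le: "(\<Sum>m<N. ennreal (c m) * indicator (A m) x) \<le> ennreal (h x / x) * indicator {0<..<C} x" for N x
  proof (cases "\<exists>k<N. x \<in> A k")
    case True
    then obtain k where k: "k < N" "x \<in> A k" by blast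
    have "x \<notin> A m" if "m \<noteq> k" for m
    proof (cases "m < k")
      case True
      then have "C * l ^ k \<le> C * l ^ Suc m" using l C by (intro mult_left_mono power_decreasing) auto
      then show ?thesis using k by (auto simp: A_def)
    next
      case False
      then have "C * l ^ m \<le> C * l ^ Suc k" using l C that by (intro mult_left_mono power_decreasing) auto
      then show ?thesis using k by (auto simp: A_def)
    qed
    then have "(\<Sum>m<N. ennreal (c m) * indicator (A m) x) = (\<Sum>m\<in>{k}. ennreal (c m) * indicator (A m) x)"
      using k by (intro sum.mono_neutral_right) auto
    also have "\<dots> = ennreal (c k)" using k by simp
    also have "\<dots> \<le> ennreal (h x / x)"
    proof (rule ennreal_leI)
      have x: "C * l ^ Suc k < x" "x < C * l ^ k" using k by (auto simp: A_def)
      have p: "0 < C * l ^ Suc k" using l C by simp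
      have "h (C * l ^ Suc k) \<le> h x" using x p by (intro mono_onD [OF mono]) auto
      then show "c k \<le> h x / x" unfolding c_def using x p pos by (intro frac_le) auto
    qed
    also have "\<dots> = ennreal (h x / x) * indicator {0<..<C} x"
    proof -
      have "0 < C * l ^ Suc k" "C * l ^ k \<le> C * 1" using l C by (auto intro!: mult_left_mono power_le_one)
      then have "x \<in> {0<..<C}" using k by (auto simp: A_def)
      then show ?thesis by simp
    qed
    finally show ?thesis .
  next
    case False
    then have "(\<Sum>m<N. ennreal (c m) * indicator (A m) x) = 0" by (intro sum.neutral) auto
    then show ?thesis by simp
  qed
  have "(\<Sum>m<N. h (C * l ^ Suc m)) \<le> enn2real ?I / (1 - l)" for N
  proof -
    have em: "ennreal (c m) * emeasure lborel (A m) = ennreal ((1 - l) * h (C * l ^ Suc m))" for m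
    proof -
      have "C * l ^ Suc m \<le> C * l ^ m" using l C by (intro mult_left_mono power_decreasing) auto
      then have "emeasure lborel (A m) = ennreal (C * l ^ m - C * l ^ Suc m)" by (simp add: A_def)
      moreover have "c m * (C * l ^ m - C * l ^ Suc m) = (1 - l) * h (C * l ^ Suc m)"
        using l C by (simp add: c_def field_simps)
      ultimately show ?thesis using c by (simp add: ennreal_mult'' [symmetric] ennreal_mult' [symmetric])
    qed
    have "ennreal (\<Sum>m<N. (1 - l) * h (C * l ^ Suc m)) = (\<Sum>m<N. ennreal ((1 - l) * h (C * l ^ Suc m)))"
      using l C pos by (intro sum_ennreal [symmetric]) auto
    also have "\<dots> = (\<Sum>m<N. \<integral>\<^sup>+ x. ennreal (c m) * indicator (A m) x \<partial>lborel)"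
    proof (rule sum.cong [OF refl])
      fix m
      have "A m \<in> sets lborel" by (simp add: A_def)
      then show "ennreal ((1 - l) * h (C * l ^ Suc m)) = (\<integral>\<^sup>+ x. ennreal (c m) * indicator (A m) x \<partial>lborel)"
        by (simp only: em nn_integral_cmult_indicator)
    qed
    also have "\<dots> = (\<integral>\<^sup>+ x. (\<Sum>m<N. ennreal (c m) * indicator (A m) x) \<partial>lborel)"
      by (intro nn_integral_sum [symmetric]) (simp add: A_def)
    also have "\<dots> \<le> ?I" by (intro nn_integral_mono le)
    also have "?I = ennreal (enn2real ?I)" using fin by (simp add: less_top)
    finally have "(\<Sum>m<N. (1 - l) * h (C * l ^ Suc m)) \<le> enn2real ?I"
      by (simp add: ennreal_le_iff)
    then show ?thesis using l by (simp add: sum_distrib_left [symmetric] pos_le_divide_eq mult.commute)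
  qed
  then have "summable (\<lambda>m. h (C * l ^ Suc m))"
    using l C pos by (intro summableI_nonneg_bounded) auto
  then show ?thesis by (subst (asm) summable_Suc_iff)
qed

text \<open>A ball is connected, so if it left \<open>\<Omega>\<close> it would meet the frontier at
  a distance below the minimum.\<close>

lemma ball_subset_nearest_frontier:
  fixes \<Omega> :: "'a::euclidean_space set"
  assumes "frontier \<Omega> \<noteq> {}" "z \<in> \<Omega>"
  obtains q where "q \<in> frontier \<Omega>" "ball z (dist z q) \<subseteq> \<Omega>"
proof -
  obtain q where q: "q \<in> frontier \<Omega>" "\<And>y. y \<in> frontier \<Omega> \<Longrightarrow> dist z q \<le> dist z y"
    using distance_attains_inf [OF frontier_closed assms(1)] by blast
  have "ball z (dist z q) \<subseteq> \<Omega>"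
  proof (rule ccontr)
    assume n: "\<not> ball z (dist z q) \<subseteq> \<Omega>"
    then have "ball z (dist z q) \<noteq> {}" by auto
    then have "z \<in> ball z (dist z q)" by simp
    then have "ball z (dist z q) \<inter> frontier \<Omega> \<noteq> {}"
      using n assms(2) by (intro connected_Int_frontier connected_ball) blast+
    then show False using q(2) by force
  qed
  with q that show ?thesis by blast
qed

lemma geodesic_deriv_bound:
  fixes \<Omega> :: "(complex ^ 'n) set"
  assumes \<Omega>: "open \<Omega>" "convex \<Omega>" "bounded \<Omega>" "frontier \<Omega> \<noteq> {}" and u: "is_canonical_function \<Omega> u"
    and \<omega>: "modulus_of_continuity (closure \<Omega>) u \<omega>" and Dini: "Dini (\<lambda>x. sqrt (\<omega> x))"
    and \<psi>: "complex_geodesic \<Omega> \<psi>"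
  obtains h where "summable h" "\<And>m \<zeta>. \<zeta> \<in> ball 0 1 \<Longrightarrow> 1 - cmod \<zeta> < (1 / 3) ^ Suc m \<Longrightarrow>
    norm (\<chi> i. deriv (\<lambda>x. \<psi> x $ i) \<zeta>) * (1 - cmod \<zeta>) \<le> h m"
proof -
  obtain l C where l: "0 < l" "l < 1" "C > 0"
    and bd: "\<And>m \<zeta> d. \<zeta> \<in> ball 0 1 \<Longrightarrow> 1 - cmod \<zeta> < (1 / 3) ^ Suc m \<Longrightarrow> ball (\<psi> \<zeta>) d \<subseteq> \<Omega> \<Longrightarrow> d \<le> C * l ^ m"
    using geodesic_boundary_distance [OF \<Omega>(1-3) \<psi>] by blast
  have disc: "\<psi> \<in> hol_discs \<Omega>" and im: "\<psi> ` ball 0 1 \<subseteq> \<Omega>"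
    using \<psi> by (auto simp: complex_geodesic_def hol_discs_def)
  have mono: "mono_on {0..} \<omega>" and \<omega>0: "\<And>r. r \<ge> 0 \<Longrightarrow> \<omega> r \<ge> 0"
    and uc: "\<And>x y. x \<in> closure \<Omega> \<Longrightarrow> y \<in> closure \<Omega> \<Longrightarrow> \<bar>u x - u y\<bar> \<le> \<omega> (norm (x - y))"
    using \<omega> by (auto simp: modulus_of_continuity_def)
  obtain B where B: "B > 0" "\<And>z. z \<in> closure \<Omega> \<Longrightarrow> norm z \<le> B"
    using bounded_closure [OF \<Omega>(3)] unfolding bounded_pos by blast
  \<comment> \<open>The first summand comes from the modulus of \<open>u\<close> and is summable by
    the Dini condition; the second comes from the Lipschitz bound for
    \<open>2 * (norm z)\<^sup>2\<close> on the closure and is geometric. The factor 3 is that of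
    \<open>norm_deriv_disc_le\<close>.\<close>
  define h where "h m = 3 * (sqrt (\<omega> (C * l ^ m)) + sqrt (4 * B * C) * sqrt l ^ m)" for m
  show ?thesis
  proof
    have "summable (\<lambda>m. sqrt (\<omega> (C * l ^ m)))"
    proof (rule summable_Dini [where h = "\<lambda>x. sqrt (\<omega> x)"])
      show "mono_on {0..} (\<lambda>x. sqrt (\<omega> x))" using mono by (auto simp: mono_on_def)
    qed (use \<omega>0 Dini l in auto)
    moreover have "summable (\<lambda>m. sqrt l ^ m)" using l by (intro summable_geometric) simp
    ultimately show "summable h" unfolding h_def by (intro summable_mult summable_add)
  next
    fix m \<zeta> assume \<zeta>: "\<zeta> \<in> ball 0 1" and m: "1 - cmod \<zeta> < (1 / 3) ^ Suc m"
    let ?z = "\<psi> \<zeta>"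
    have z: "?z \<in> \<Omega>" using im \<zeta> by auto
    then have zc: "?z \<in> closure \<Omega>" using closure_subset by blast
    obtain q where q: "q \<in> frontier \<Omega>" "ball ?z (dist ?z q) \<subseteq> \<Omega>"
      using ball_subset_nearest_frontier [OF \<Omega>(4) z] .
    have qc: "q \<in> closure \<Omega>" using q(1) by (simp add: frontier_def)
    let ?d = "C * l ^ m"
    have d: "norm (q - ?z) \<le> ?d" using bd [OF \<zeta> m q(2)] by (simp add: dist_norm norm_minus_commute)
    have uq: "u q = - 2 * (norm q)\<^sup>2" using u q(1) by (simp add: is_canonical_function_def)
    have "u q - u ?z \<le> \<omega> (norm (q - ?z))" using uc [OF qc zc] by simp
    also have "\<dots> \<le> \<omega> ?d" using d l by (intro mono_onD [OF mono]) auto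
    finally have 1: "u q - u ?z \<le> \<omega> ?d" .
    have "(norm q)\<^sup>2 - (norm ?z)\<^sup>2 = (norm q + norm ?z) * (norm q - norm ?z)"
      by (simp add: power2_eq_square algebra_simps)
    also have "\<dots> \<le> (norm q + norm ?z) * norm (q - ?z)"
      by (intro mult_left_mono norm_triangle_ineq2) auto
    also have "\<dots> \<le> (B + B) * ?d" using B qc zc d by (intro mult_mono add_mono) auto
    finally have "- (u ?z + 2 * (norm ?z)\<^sup>2) \<le> \<omega> ?d + 4 * B * C * l ^ m"
      using 1 uq by simp
    then have "sqrt (- (u ?z + 2 * (norm ?z)\<^sup>2)) \<le> sqrt (\<omega> ?d + 4 * B * C * l ^ m)"
      by (rule real_sqrt_le_mono)
    also have "\<dots> \<le> sqrt (\<omega> ?d) + sqrt (4 * B * C * l ^ m)"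
      using \<omega>0 l B by (intro sqrt_add_le_add_sqrt) auto
    finally have "3 * sqrt (- (u ?z + 2 * (norm ?z)\<^sup>2)) \<le> h m"
      by (simp add: h_def real_sqrt_mult real_sqrt_power)
    then show "norm (\<chi> i. deriv (\<lambda>x. \<psi> x $ i) \<zeta>) * (1 - cmod \<zeta>) \<le> h m"
      using norm_deriv_disc_le [OF \<Omega>(1-3) u disc \<zeta>] by linarith
  qed
qed

section \<open>Boundary extension\<close>

text \<open>The dilates of \<open>f\<close> are continuous on the closed disc, and their telescoping
  series converges uniformly there by the Weierstrass test.\<close>

lemma holomorphic_extends_continuously:
  assumes f: "f holomorphic_on ball 0 1" and h: "summable h"
    and bound: "\<And>m \<zeta>. \<zeta> \<in> ball 0 1 \<Longrightarrow> 1 - cmod \<zeta> < (1 / 3) ^ Suc m \<Longrightarrow>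
      cmod (deriv f \<zeta>) * (1 - cmod \<zeta>) \<le> h m"
  shows "\<exists>F. continuous_on (cball 0 1) F \<and> (\<forall>z\<in>ball 0 1. F z = f z)"
proof -
  \<comment> \<open>The exponent \<open>m + 2\<close> makes \<open>bound\<close> at level
    \<open>m\<close>, a strict condition, available on the whole radial segment from radius
    \<open>r m\<close> to \<open>r (Suc m)\<close>.\<close>
  define r :: "nat \<Rightarrow> real" where "r m = 1 - (1 / 3) ^ (m + 2)" for m
  define g where "g m z = f (of_real (r (Suc m)) * z) - f (of_real (r m) * z)" for m z
  have r: "0 \<le> r m" "r m < 1" for m unfolding r_def using power_le_one [of "1 / 3 :: real" "m + 2"] zero_less_power [of "1 / 3 :: real" "m + 2"] by linarith+
  have rz: "of_real (r m) * z \<in> ball 0 1" if "z \<in> cball 0 1" for m and z :: complex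
    using that r [of m] mult_left_mono [of "cmod z" 1 "r m"] by (simp add: norm_mult)
  have contf: "continuous_on (cball 0 1) (\<lambda>z. f (of_real (r m) * z))" for m
    using rz by (intro continuous_on_compose2 [OF holomorphic_on_imp_continuous_on [OF f]] continuous_intros) auto
  have contg: "continuous_on (cball 0 1) (g m)" for m
    unfolding g_def by (intro continuous_intros contf)
  have holf: "(\<lambda>z. f (of_real (r m) * z)) holomorphic_on ball 0 1" for m
  proof -
    have "f \<circ> (\<lambda>z. of_real (r m) * z) holomorphic_on ball 0 1"
      using rz by (intro holomorphic_on_compose_gen [OF _ f] holomorphic_intros) force
    then show ?thesis by (simp add: o_def)
  qed
  have sphere: "cmod (g m z) \<le> 2 * h m" if z: "cmod z = 1" for m z
  proof -
    let ?S = "closed_segment (of_real (r m) * z) (of_real (r (Suc m)) * z)"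
    have w: "w \<in> ball 0 1 \<and> cmod (deriv f w) \<le> h m * 3 ^ (m + 3)" if w: "w \<in> ?S" for w
    proof -
      obtain t where t: "0 \<le> t" "t \<le> 1" and
        weq: "w = (1 - t) *\<^sub>R (of_real (r m) * z) + t *\<^sub>R (of_real (r (Suc m)) * z)"
        using w by (auto simp: in_segment)
      define s where "s = (1 - t) * (1 / 3) ^ (m + 2) + t * (1 / 3) ^ (m + 3)"
      have wz: "w = of_real (1 - s) * z"
        unfolding weq s_def by (simp add: r_def scaleR_conv_of_real power_add power_divide algebra_simps)
      \<comment> \<open>\<open>q\<close> is the distance of the outer endpoint from the circle. The
        segment has length \<open>2 * q\<close>, so the derivative bound \<open>h m / q\<close>
        integrates to \<open>2 * h m\<close>.\<close>
      define q :: real where "q = (1 / 3) ^ (m + 3)"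
      have e: "(1 / 3 :: real) ^ (m + 2) = 3 * q" "(1 / 3 :: real) ^ Suc m = 9 * q"
        by (simp_all add: q_def power_add power_divide)
      have q: "q > 0" "q * 3 ^ (m + 3) = 1"
        unfolding q_def by (simp, simp only: flip: power_mult_distrib) simp
      have "s = (3 - 2 * t) * q" unfolding s_def e(1) q_def [symmetric] by (simp add: algebra_simps)
      then have s: "q \<le> s" "s \<le> 3 * q" using t q(1) by simp_all
      have s0: "0 < s" using s(1) q(1) by linarith
      have s1: "s < 1" using s(2) e(1) power_strict_decreasing [of 0 "m + 2" "1 / 3 :: real"] by simp
      then have cw: "cmod w = 1 - s"
        unfolding wz using z by (simp add: norm_mult del: of_real_diff)
      then have wb: "w \<in> ball 0 1" using s0 by simp
      have "1 - cmod w < (1 / 3) ^ Suc m" unfolding e(2) using cw s(2) q(1) by linarith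
      then have "cmod (deriv f w) * s \<le> h m" using bound [OF wb] cw by simp
      moreover have "cmod (deriv f w) * q \<le> cmod (deriv f w) * s" using s by (intro mult_left_mono) auto
      ultimately have "cmod (deriv f w) * q * 3 ^ (m + 3) \<le> h m * 3 ^ (m + 3)"
        by (intro mult_right_mono) auto
      then show ?thesis using wb by (simp only: mult.assoc q(2) mult_1_right)
    qed
    have "cmod (g m z) \<le> h m * 3 ^ (m + 3) * cmod (of_real (r (Suc m)) * z - of_real (r m) * z)"
      unfolding g_def
    proof (rule field_differentiable_bound [of ?S f "deriv f"])
      show "(f has_field_derivative deriv f w) (at w within ?S)" if "w \<in> ?S" for w
        using w [OF that] by (intro has_field_derivative_at_within [OF holomorphic_derivI [OF f open_ball]]) auto
    qed (use w in auto)
    also have "of_real (r (Suc m)) * z - of_real (r m) * z = of_real (2 * (1 / 3) ^ (m + 3)) * z"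
      by (simp add: r_def power_add power_divide algebra_simps)
    also have "h m * 3 ^ (m + 3) * cmod \<dots> = 2 * h m * (3 ^ (m + 3) * (1 / 3) ^ (m + 3))"
      using z by (simp only: norm_mult norm_of_real) simp
    also have "\<dots> = 2 * h m" by (simp only: flip: power_mult_distrib) simp
    finally show ?thesis .
  qed
  \<comment> \<open>For interior \<open>z\<close> the segment may be far from the circle, where
    \<open>bound\<close> at level \<open>m\<close> says nothing; the maximum modulus principle
    carries the estimate inwards.\<close>
  have gb: "cmod (g m z) \<le> 2 * h m" if "z \<in> cball 0 1" for m z
  proof (rule maximum_modulus_frontier [of "g m" "cball 0 1"])
    show "g m holomorphic_on interior (cball 0 1)"
      unfolding g_def interior_cball by (intro holomorphic_intros holf)
  qed (use that contg sphere in \<open>auto simp: frontier_cball\<close>)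
  have ul: "uniform_limit (cball 0 1) (\<lambda>n z. \<Sum>i<n. g i z) (\<lambda>z. \<Sum>i. g i z) sequentially"
    using gb h by (intro Weierstrass_m_test [of _ _ "\<lambda>m. 2 * h m"] summable_mult) auto
  let ?F = "\<lambda>z. f (of_real (r 0) * z) + (\<Sum>i. g i z)"
  have "continuous_on (cball 0 1) (\<lambda>z. \<Sum>i. g i z)"
    by (rule uniform_limit_theorem [OF _ ul]) (auto intro!: always_eventually continuous_on_sum contg)
  then have "continuous_on (cball 0 1) ?F" by (intro continuous_intros contf)
  moreover have "?F z = f z" if z: "z \<in> ball 0 1" for z
  proof -
    have "(\<Sum>i<n. g i z) = f (of_real (r n) * z) - f (of_real (r 0) * z)" for n
      unfolding g_def by (rule sum_lessThan_telescope)
    then have "(\<lambda>n. f (of_real (r n) * z) - f (of_real (r 0) * z)) \<longlonglongrightarrow> (\<Sum>i. g i z)"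
      using tendsto_uniform_limitI [OF ul, of z] z by simp
    moreover have "(\<lambda>n. f (of_real (r n) * z) - f (of_real (r 0) * z)) \<longlonglongrightarrow> f z - f (of_real (r 0) * z)"
    proof (intro tendsto_intros isCont_tendsto_compose [of z f])
      show "isCont f z"
        using f z by (meson continuous_on_eq_continuous_at holomorphic_on_imp_continuous_on open_ball)
      have "r \<longlonglongrightarrow> 1 - 0"
        unfolding r_def by (intro tendsto_intros LIMSEQ_ignore_initial_segment LIMSEQ_realpow_zero) auto
      then have "(\<lambda>n. of_real (r n) * z) \<longlonglongrightarrow> of_real 1 * z"
        by (intro tendsto_intros) simp
      then show "(\<lambda>n. of_real (r n) * z) \<longlonglongrightarrow> z" by simp
    qed
    ultimately have "(\<Sum>i. g i z) = f z - f (of_real (r 0) * z)" by (rule LIMSEQ_unique)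
    then show ?thesis by simp
  qed
  ultimately show ?thesis by blast
qed

text \<open>The norm of the derivative vector dominates every coordinate, so one summable
  \<open>h\<close> serves all coordinate functions.\<close>

lemma geodesic_extends_continuously:
  fixes \<Omega> :: "(complex ^ 'n) set"
  assumes \<Omega>: "bounded \<Omega>" "C_strictly_convex \<Omega>" and u: "is_canonical_function \<Omega> u"
    and \<omega>: "modulus_of_continuity (closure \<Omega>) u \<omega>" "Dini (\<lambda>x. sqrt (\<omega> x))"
    and \<psi>: "complex_geodesic \<Omega> \<psi>"
  shows "\<exists>\<Psi>. continuous_on (cball 0 1) \<Psi> \<and> (\<forall>z \<in> ball 0 1. \<Psi> z = \<psi> z)"
proof -
  have oc: "open \<Omega>" "convex \<Omega>" using \<Omega>(2) by (auto simp: C_strictly_convex_def)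
  obtain h where h: "summable h" "\<And>m \<zeta>. \<zeta> \<in> ball 0 1 \<Longrightarrow> 1 - cmod \<zeta> < (1 / 3) ^ Suc m \<Longrightarrow>
      norm (\<chi> i. deriv (\<lambda>x. \<psi> x $ i) \<zeta>) * (1 - cmod \<zeta>) \<le> h m"
    using geodesic_deriv_bound [OF oc \<Omega>(1) frontier_nonempty_C_strictly_convex [OF \<Omega>(2)] u \<omega> \<psi>] by blast
  have "\<exists>F. continuous_on (cball 0 1) F \<and> (\<forall>z\<in>ball 0 1. F z = \<psi> z $ i)" for i
  proof (rule holomorphic_extends_continuously [OF _ h(1)])
    show "(\<lambda>z. \<psi> z $ i) holomorphic_on ball 0 1"
      using \<psi> by (simp add: complex_geodesic_def hol_discs_def)
    fix m \<zeta> assume \<zeta>: "\<zeta> \<in> ball (0::complex) 1" "1 - cmod \<zeta> < (1 / 3) ^ Suc m"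
    have "cmod (deriv (\<lambda>z. \<psi> z $ i) \<zeta>) \<le> norm (\<chi> i. deriv (\<lambda>x. \<psi> x $ i) \<zeta>)"
      using Finite_Cartesian_Product.norm_nth_le [of "\<chi> i. deriv (\<lambda>x. \<psi> x $ i) \<zeta>" i] by simp
    then show "cmod (deriv (\<lambda>z. \<psi> z $ i) \<zeta>) * (1 - cmod \<zeta>) \<le> h m"
      using \<zeta> by (intro order_trans [OF mult_right_mono h(2)]) auto
  qed
  then obtain F where F: "\<And>i. continuous_on (cball 0 1) (F i)" "\<And>i z. z \<in> ball 0 1 \<Longrightarrow> F i z = \<psi> z $ i"
    by metis
  show ?thesis
  proof (intro exI conjI ballI)
    show "continuous_on (cball 0 1) (\<lambda>z. \<chi> i. F i z)" using F(1) by (intro continuous_intros)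
    show "(\<chi> i. F i z) = \<psi> z" if "z \<in> ball 0 1" for z using F(2) [OF that] by (simp add: vec_eq_iff)
  qed
qed

theorem theorem1p8:
  fixes \<Omega> :: "(complex ^ 'n) set"
  assumes "bounded \<Omega>" and "C_strictly_convex \<Omega>"
  shows "B_regular \<Omega> \<and>
    (\<forall>u. is_canonical_function \<Omega> u \<longrightarrow>
       (\<exists>\<omega>. modulus_of_continuity (closure \<Omega>) u \<omega> \<and> Dini (\<lambda>x. sqrt (\<omega> x))) \<longrightarrow>
       (\<forall>\<psi>. complex_geodesic \<Omega> \<psi> \<longrightarrow>
          (\<exists>\<Psi>. continuous_on (cball 0 1) \<Psi> \<and> (\<forall>z \<in> ball 0 1. \<Psi> z = \<psi> z))))"
  using B_regular_C_strictly_convex [OF assms] geodesic_extends_continuously [OF assms] by blast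

end
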